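(* Let $F$ be a field with at least $4$ elements. The $R_F$-module homomorphism $$\mathcal{RP}'(F)[\tfrac12]\to\mathcal{RP}_1(F)[\tfrac12],\qquad [x]'\mapsto \mathrm e^+_{-1}[x]+\tfrac12\langle\!\langle1-x\rangle\!\rangle\psi_1(x)\quad(x\ne1),\qquad [1]'\mapsto 0,$$ is an isomorphism.
   Context: For an abelian group $A$, $A[\frac12]=A\otimes\mathbb Z[\frac12]$. For a field $F$, $R_F=\mathbb Z[F^\times/(F^\times)^2]$; $\langle x\rangle\in R_F$ is the square class of $x\in F^\times$; $\langle\!\langle x\rangle\!\rangle=\langle x\rangle-1$; $\mathcal I_F\subset R_F$ is the augmentation ideal; $\mathrm e^+_{-1}=\frac{1+\langle-1\rangle}2\in R_F[\frac12]$. For a field $F$ with at least $4$ elements, $\mathcal{RP}(F)$ is the $R_F$-module with generators $[x]$, $x\in F^\times$, and relations $[1]=0$ and, for all $x,y\in F^\times\setminus\{1\}$, $$0=[x]-[y]+\langle x\rangle\left[\tfrac yx\right]-\langle x^{-1}-1\rangle\left[\tfrac{1-x^{-1}}{1-y^{-1}}\right]+\langle 1-x\rangle\left[\tfrac{1-x}{1-y}\right].$$ $\lambda_1:\mathcal{RP}(F)\to\mathcal I_F^2$ is the (well-defined) $R_F$-homomorphism with $[x]\mapsto\langle\!\langle 1-x\rangle\!\rangle\langle\!\langle x\rangle\!\rangle$ for $x\neq1$, and $\mathcal{RP}_1(F)=\ker\lambda_1$. Put $\psi_1(x)=[x]+\langle-1\rangle[x^{-1}]\in\mathcal{RP}(F)$.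 $\mathcal{RP}'(F)$ is the $R_F$-module with generators $[x]'$, $x\in F^\times$, subject to the relations: (1) $[1]'=0$; (2) $[x]'-[y]'+\langle x\rangle\left[\frac yx\right]'-\langle x^{-1}-1\rangle\left[\frac{1-x^{-1}}{1-y^{-1}}\right]'+\langle1-x\rangle\left[\frac{1-x}{1-y}\right]'=0$ for all $x,y\in F^\times\setminus\{1\}$; (3) $\langle-1\rangle[x]'=[x]'$ for all $x\in F^\times$; (4) $[x]'+[x^{-1}]'=0$ for all $x\in F^\times$. *)

theory Defs
  imports Complex_Main "HOL-Library.Poly_Mapping"
begin

section \<open>Free modules and congruence modulo a submodule\<close>

text \<open>
  The free \<open>'r\<close>-module on \<open>'b\<close> is the type of finitely supported functions
  \<open>'b \<Rightarrow>\<^sub>0 'r\<close>.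
\<close>

definition fscale :: "'r::comm_ring_1 \<Rightarrow> ('b \<Rightarrow>\<^sub>0 'r) \<Rightarrow> ('b \<Rightarrow>\<^sub>0 'r)"
  where "fscale r p = Poly_Mapping.map ((*) r) p"

lemma lookup_fscale [simp]:
  "Poly_Mapping.lookup (fscale r p) b = r * Poly_Mapping.lookup p b"
  by (cases "Poly_Mapping.lookup p b = 0") (auto simp: fscale_def Poly_Mapping.map.rep_eq)

interpretation free: module fscale
  by unfold_locales (auto intro!: poly_mapping_eqI simp: lookup_add algebra_simps)

definition free_gen :: "'b \<Rightarrow> ('b \<Rightarrow>\<^sub>0 'r::comm_ring_1)"
  where "free_gen b = Poly_Mapping.single b 1"

definition free_lift ::
    "('r::comm_ring_1 \<Rightarrow> 'm::ab_group_add \<Rightarrow> 'm) \<Rightarrow> ('b \<Rightarrow> 'm) \<Rightarrow> ('b \<Rightarrow>\<^sub>0 'r) \<Rightarrow> 'm"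
  where "free_lift s g p = (\<Sum>b\<in>Poly_Mapping.keys p. s (Poly_Mapping.lookup p b) (g b))"

lemma free_lift_superset:
  assumes "module s" "finite A" "Poly_Mapping.keys p \<subseteq> A"
  shows "free_lift s g p = (\<Sum>b\<in>A. s (Poly_Mapping.lookup p b) (g b))"
proof -
  interpret module s by fact
  show ?thesis
    unfolding free_lift_def using assms(2,3)
    by (intro sum.mono_neutral_left) (auto simp: in_keys_iff)
qed

lemma module_hom_free_lift:
  assumes "module s"
  shows "module_hom fscale s (free_lift s g)"
proof -
  interpret module s by fact
  show ?thesis
  proof unfold_locales
    fix p q :: "'c \<Rightarrow>\<^sub>0 'a"
    let ?A = "Poly_Mapping.keys p \<union> Poly_Mapping.keys q"
    have "Poly_Mapping.keys (p + q) \<subseteq> ?A"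
      by (rule Poly_Mapping.keys_add)
    then show "free_lift s g (p + q) = free_lift s g p + free_lift s g q"
      using free_lift_superset[OF assms, of ?A p g] free_lift_superset[OF assms, of ?A q g]
        free_lift_superset[OF assms, of ?A "p + q" g]
      by (simp add: lookup_add scale_left_distrib sum.distrib)
  next
    fix r :: 'a and p :: "'c \<Rightarrow>\<^sub>0 'a"
    have "Poly_Mapping.keys (fscale r p) \<subseteq> Poly_Mapping.keys p"
      by (auto simp: in_keys_iff)
    then show "free_lift s g (fscale r p) = s r (free_lift s g p)"
      using free_lift_superset[OF assms, of "Poly_Mapping.keys p" "fscale r p" g]
      by (simp add: free_lift_def scale_sum_right)
  qed
qed

lemma free_lift_gen [simp]:
  assumes "module s"
  shows "free_lift s g (free_gen b) = g b"
proof -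
  interpret module s by fact
  show ?thesis by (simp add: free_lift_def free_gen_def)
qed

definition module_cong ::
    "('b \<Rightarrow>\<^sub>0 'r::comm_ring_1) set \<Rightarrow> ('b \<Rightarrow>\<^sub>0 'r) \<Rightarrow> ('b \<Rightarrow>\<^sub>0 'r) \<Rightarrow> bool"
  where "module_cong S p q \<longleftrightarrow> p - q \<in> module.span fscale S"

lemma equivp_module_cong: "equivp (module_cong S)"
proof (rule equivpI)
  show "reflp (module_cong S)"
    by (simp add: reflp_def module_cong_def free.span_zero)
  show "symp (module_cong S)"
    unfolding symp_def module_cong_def by (metis free.span_neg minus_diff_eq)
  show "transp (module_cong S)"
    unfolding transp_def module_cong_def using free.span_add by fastforce
qed

lemma module_cong_add:
  "module_cong S p p' \<Longrightarrow> module_cong S q q' \<Longrightarrow> module_cong S (p + q) (p' + q')"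
  unfolding module_cong_def using free.span_add[of "p - p'" S "q - q'"]
  by (simp add: algebra_simps)

lemma module_cong_diff:
  "module_cong S p p' \<Longrightarrow> module_cong S q q' \<Longrightarrow> module_cong S (p - q) (p' - q')"
  unfolding module_cong_def using free.span_diff[of "p - p'" S "q - q'"]
  by (simp add: algebra_simps)

lemma module_cong_uminus: "module_cong S p p' \<Longrightarrow> module_cong S (- p) (- p')"
  unfolding module_cong_def using free.span_neg[of "p - p'" S] by simp

lemma module_cong_scale: "module_cong S p p' \<Longrightarrow> module_cong S (fscale r p) (fscale r p')"
  unfolding module_cong_def using free.span_scale[of "p - p'" S r]
  by (simp add: free.scale_right_diff_distrib)

lemma free_lift_module_cong:
  assumes "module s" "\<And>p. p \<in> S \<Longrightarrow> free_lift s g p = 0" "module_cong S p q"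
  shows "free_lift s g p = free_lift s g q"
proof -
  interpret module_hom fscale s "free_lift s g" by (rule module_hom_free_lift) fact
  have "free_lift s g (p - q) = 0"
    using assms(3) unfolding module_cong_def
    by (induction rule: free.span_induct_alt) (auto simp: add scale assms(2))
  then show ?thesis by (simp add: diff)
qed


section \<open>Tensor products of abelian groups\<close>

definition int_scale :: "int \<Rightarrow> 'a::ab_group_add \<Rightarrow> 'a"
  where "int_scale k a = (\<Sum>i<nat k. a) - (\<Sum>i<nat (- k). a)"

lemma module_int_scale: "module (int_scale :: int \<Rightarrow> 'a::ab_group_add \<Rightarrow> 'a)"
proof -
  define N where "N n a = (\<Sum>i<n. a)" for n :: nat and a :: 'a
  have N_add: "N (m + n) a = N m a + N n a" for m n a
    by (induction n) (auto simp: N_def algebra_simps)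
  have N_mult: "N (m * n) a = N m (N n a)" for m n a
    by (induction m) (simp_all add: N_add, simp_all add: N_def algebra_simps)
  have sc: "int_scale (int m - int n) a = N m a - N n a" for m n a
  proof (cases "n \<le> m")
    case True
    then obtain d where "m = n + d" using le_Suc_ex by blast
    then show ?thesis by (simp add: int_scale_def N_add) (simp add: N_def)
  next
    case False
    then obtain d where "n = m + d" using le_Suc_ex nat_le_linear by blast
    then show ?thesis by (simp add: int_scale_def N_add) (simp add: N_def)
  qed
  have N_distrib: "N n (a + b) = N n a + N n b" "N n (a - b) = N n a - N n b" for n a b
    by (simp_all add: N_def sum.distrib sum_subtractf)
  have ex: "\<exists>m n. k = int m - int n" for k
    by (metis int_diff_cases)
  show ?thesis
  proof
    fix k l :: int and a b :: 'a
    obtain m n m' n' where k: "k = int m - int n" and l: "l = int m' - int n'"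
      using ex by metis
    show "int_scale k (a + b) = int_scale k a + int_scale k b"
      unfolding k sc by (simp add: N_distrib)
    have "k + l = int (m + m') - int (n + n')" unfolding k l by simp
    then show "int_scale (k + l) a = int_scale k a + int_scale l a"
      by (simp only: k l sc N_add) simp
    have "k * l = int (m * m' + n * n') - int (m * n' + n * m')"
      unfolding k l by (simp add: algebra_simps)
    then show "int_scale k (int_scale l a) = int_scale (k * l) a"
      by (simp only: k l sc N_add N_mult N_distrib) simp
    show "int_scale 1 a = a" by (simp add: int_scale_def)
  qed
qed

definition tensor_rels :: "('a::ab_group_add \<times> 'b::ab_group_add \<Rightarrow>\<^sub>0 int) set"
  where "tensor_rels =
    {free_gen (a + a', b) - free_gen (a, b) - free_gen (a', b) | a a' b. True} \<union>
    {free_gen (a, b + b') - free_gen (a, b) - free_gen (a, b') | a b b'. True}"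

quotient_type (overloaded) ('a, 'b) tensor =
    "'a::ab_group_add \<times> 'b::ab_group_add \<Rightarrow>\<^sub>0 int" / "module_cong tensor_rels"
  by (rule equivp_module_cong)

instantiation tensor :: (ab_group_add, ab_group_add) ab_group_add
begin
lift_definition zero_tensor :: "('a, 'b) tensor" is 0 .
lift_definition plus_tensor :: "('a, 'b) tensor \<Rightarrow> ('a, 'b) tensor \<Rightarrow> ('a, 'b) tensor"
  is "(+)" by (rule module_cong_add)
lift_definition minus_tensor :: "('a, 'b) tensor \<Rightarrow> ('a, 'b) tensor \<Rightarrow> ('a, 'b) tensor"
  is "(-)" by (rule module_cong_diff)
lift_definition uminus_tensor :: "('a, 'b) tensor \<Rightarrow> ('a, 'b) tensor"
  is uminus by (rule module_cong_uminus)
instance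
  by standard (transfer, simp add: algebra_simps equivp_reflp[OF equivp_module_cong])+
end

definition tens :: "'a::ab_group_add \<Rightarrow> 'b::ab_group_add \<Rightarrow> ('a, 'b) tensor"
  where "tens a b = abs_tensor (free_gen (a, b))"

definition biadditive ::
    "('a::ab_group_add \<Rightarrow> 'b::ab_group_add \<Rightarrow> 'c::ab_group_add) \<Rightarrow> bool"
  where "biadditive f \<longleftrightarrow>
    (\<forall>a a' b. f (a + a') b = f a b + f a' b) \<and> (\<forall>a b b'. f a (b + b') = f a b + f a b')"

text \<open>
  The homomorphism induced by a biadditive map. It is evaluated on a chosen representative,
  so it is meaningful only for biadditive \<open>f\<close>.
\<close>

definition tensor_lift ::
    "('a::ab_group_add \<Rightarrow> 'b::ab_group_add \<Rightarrow> 'c::ab_group_add) \<Rightarrow> ('a, 'b) tensor \<Rightarrow> 'c"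
  where "tensor_lift f t = free_lift int_scale (\<lambda>(a, b). f a b) (rep_tensor t)"

lemma tensor_lift_abs:
  assumes "biadditive f"
  shows "tensor_lift f (abs_tensor p) = free_lift int_scale (\<lambda>(a, b). f a b) p"
proof -
  interpret h: module_hom fscale int_scale "free_lift int_scale (\<lambda>(a, b). f a b)"
    by (rule module_hom_free_lift[OF module_int_scale])
  have "module_cong tensor_rels (rep_tensor (abs_tensor p)) p"
    by (rule Quotient3_rep_abs[OF Quotient3_tensor])
      (rule equivp_reflp[OF equivp_module_cong])
  then show ?thesis
    unfolding tensor_lift_def
    by (rule free_lift_module_cong[OF module_int_scale, rotated])
      (use assms in \<open>auto simp: tensor_rels_def h.diff biadditive_def module_int_scale\<close>)
qed

lemma tensor_lift_tens [simp]: "biadditive f \<Longrightarrow> tensor_lift f (tens a b) = f a b"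
  by (simp add: tens_def tensor_lift_abs module_int_scale)

lemma tensor_lift_add:
  assumes "biadditive f"
  shows "tensor_lift f (t + u) = tensor_lift f t + tensor_lift f u"
proof -
  interpret h: module_hom fscale int_scale "free_lift int_scale (\<lambda>(a, b). f a b)"
    by (rule module_hom_free_lift[OF module_int_scale])
  show ?thesis
    by (induction t; induction u)
      (simp add: plus_tensor.abs_eq tensor_lift_abs[OF assms] h.add)
qed

lemma tens_add_left: "tens (a + a') b = tens a b + tens a' b"
  and tens_add_right: "tens a (b + b') = tens a b + tens a b'"
  unfolding tens_def plus_tensor.abs_eq tensor.abs_eq_iff module_cong_def
  by (rule free.span_base, force simp: tensor_rels_def algebra_simps)+

lemma biadditive_tens: "biadditive tens"
  by (simp add: biadditive_def tens_add_left tens_add_right)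

lemma tens_zero_left: "tens 0 b = 0"
  using tens_add_left[of 0 0 b] by simp

lemma tens_zero_right: "tens a 0 = 0"
  using tens_add_right[of a 0 0] by simp

lemma tens_neg_left: "tens (- a) b = - tens a b"
  using tens_add_left[of a "- a" b] by (simp add: tens_zero_left eq_neg_iff_add_eq_0 add.commute)

lemma tensor_induct [case_names zero add]:
  fixes t :: "('a::ab_group_add, 'b::ab_group_add) tensor"
  assumes "P 0" "\<And>t a b. P t \<Longrightarrow> P (t + tens a b)"
  shows "P t"
proof -
  have *: "P (t + int_scale k (tens a b))" if t: "P t" for t k a b
  proof -
    interpret module int_scale by (rule module_int_scale)
    show ?thesis
    proof (induction k rule: int_induct[where k = 0])
      case base then show ?case using t by simp
    next
      case (step1 i)
      then show ?case using assms(2)[of "t + int_scale i (tens a b)" a b]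
        by (simp add: scale_left_distrib add.assoc)
    next
      case (step2 i)
      then show ?case using assms(2)[of "t + int_scale i (tens a b)" "- a" b]
        by (simp add: scale_left_diff_distrib tens_neg_left add_diff_eq)
    qed
  qed
  interpret a: module_hom fscale int_scale "abs_tensor :: ('a \<times> 'b \<Rightarrow>\<^sub>0 int) \<Rightarrow> _"
  proof -
    have add: "abs_tensor (p + q) = abs_tensor p + abs_tensor q"
      for p q :: "'a \<times> 'b \<Rightarrow>\<^sub>0 int" by (simp add: plus_tensor.abs_eq)
    have zero: "abs_tensor (0 :: 'a \<times> 'b \<Rightarrow>\<^sub>0 int) = 0" by (simp add: zero_tensor_def)
    have neg: "abs_tensor (- p) = - abs_tensor p" for p :: "'a \<times> 'b \<Rightarrow>\<^sub>0 int"
      by (simp add: uminus_tensor.abs_eq)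
    interpret i: module "int_scale :: int \<Rightarrow> ('a, 'b) tensor \<Rightarrow> _" by (rule module_int_scale)
    have "abs_tensor (fscale k p) = int_scale k (abs_tensor p)"
      for k and p :: "'a \<times> 'b \<Rightarrow>\<^sub>0 int"
    proof (induction k rule: int_induct[where k = 0])
      case base then show ?case using zero by simp
    next
      case (step1 i) then show ?case
        by (simp add: free.scale_left_distrib i.scale_left_distrib add)
    next
      case (step2 i) then show ?case
        using add[of "fscale i p" "- p"]
        by (simp add: free.scale_left_diff_distrib i.scale_left_diff_distrib neg)
    qed
    then show "module_hom fscale int_scale (abs_tensor :: ('a \<times> 'b \<Rightarrow>\<^sub>0 int) \<Rightarrow> _)"
      by unfold_locales (simp_all add: add)
  qed
  have P_sum: "P (\<Sum>x\<in>A. int_scale (c x) (tens (fst x) (snd x)))" if "finite A" for A c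
    using that
  proof (induction A)
    case empty then show ?case by (simp add: assms(1))
  next
    case (insert x A)
    then show ?case
      using *[of "\<Sum>x\<in>A. int_scale (c x) (tens (fst x) (snd x))" "c x" "fst x" "snd x"]
      by (simp add: add.commute)
  qed
  obtain p where p: "t = abs_tensor p" by (induction t) auto
  have "p = (\<Sum>x\<in>Poly_Mapping.keys p. fscale (Poly_Mapping.lookup p x) (free_gen x))"
    by (rule poly_mapping_eqI)
      (auto simp: lookup_sum free_gen_def lookup_single when_def in_keys_iff
        if_distrib[of "(*) _"] cong: if_cong)
  then have "t = (\<Sum>x\<in>Poly_Mapping.keys p.
      int_scale (Poly_Mapping.lookup p x) (tens (fst x) (snd x)))"
    unfolding p by (metis (no_types, lifting) a.sum a.scale tens_def prod.collapse sum.cong)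
  then show ?thesis using P_sum[of "Poly_Mapping.keys p" "Poly_Mapping.lookup p"] by simp
qed


section \<open>The localisation \<open>A[1/2]\<close>\<close>

typedef dyadic = "{q :: rat. \<exists>(a :: int) (n :: nat). q = of_int a / 2 ^ n}"
  by blast

setup_lifting type_definition_dyadic

instantiation dyadic :: comm_ring_1
begin
lift_definition zero_dyadic :: dyadic is 0
  by (rule exI[of _ 0]) simp
lift_definition one_dyadic :: dyadic is 1
  by (rule exI[of _ 1], rule exI[of _ 0]) simp
lift_definition uminus_dyadic :: "dyadic \<Rightarrow> dyadic" is uminus
  by (metis minus_divide_left of_int_minus)
lift_definition plus_dyadic :: "dyadic \<Rightarrow> dyadic \<Rightarrow> dyadic" is "(+)"
proof -
  fix p q :: rat
  assume "\<exists>(a :: int) (n :: nat). p = of_int a / 2 ^ n" "\<exists>(a :: int) (n :: nat). q = of_int a / 2 ^ n"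
  then obtain a b :: int and m n :: nat where pq: "p = of_int a / 2 ^ m" "q = of_int b / 2 ^ n"
    by blast
  have "p + q = of_int (a * 2 ^ n + b * 2 ^ m) / 2 ^ (m + n)"
    unfolding pq by (simp add: field_simps power_add)
  then show "\<exists>(a :: int) (n :: nat). p + q = of_int a / 2 ^ n" by blast
qed
lift_definition minus_dyadic :: "dyadic \<Rightarrow> dyadic \<Rightarrow> dyadic" is "(-)"
proof -
  fix p q :: rat
  assume "\<exists>(a :: int) (n :: nat). p = of_int a / 2 ^ n" "\<exists>(a :: int) (n :: nat). q = of_int a / 2 ^ n"
  then obtain a b :: int and m n :: nat where pq: "p = of_int a / 2 ^ m" "q = of_int b / 2 ^ n"
    by blast
  have "p - q = of_int (a * 2 ^ n - b * 2 ^ m) / 2 ^ (m + n)"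
    unfolding pq by (simp add: field_simps power_add)
  then show "\<exists>(a :: int) (n :: nat). p - q = of_int a / 2 ^ n" by blast
qed
lift_definition times_dyadic :: "dyadic \<Rightarrow> dyadic \<Rightarrow> dyadic" is "(*)"
proof -
  fix p q :: rat
  assume "\<exists>(a :: int) (n :: nat). p = of_int a / 2 ^ n" "\<exists>(a :: int) (n :: nat). q = of_int a / 2 ^ n"
  then obtain a b :: int and m n :: nat where pq: "p = of_int a / 2 ^ m" "q = of_int b / 2 ^ n"
    by blast
  have "p * q = of_int (a * b) / 2 ^ (m + n)"
    unfolding pq by (simp add: field_simps power_add)
  then show "\<exists>(a :: int) (n :: nat). p * q = of_int a / 2 ^ n" by blast
qed
instance
  by standard (transfer, simp add: algebra_simps)+
end

lift_definition half :: dyadic is "1 / 2"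
  by (rule exI[of _ 1], rule exI[of _ 1]) simp

type_synonym 'a loc2 = "('a, dyadic) tensor"

definition loc_map :: "('a::ab_group_add \<Rightarrow> 'b::ab_group_add) \<Rightarrow> 'a loc2 \<Rightarrow> 'b loc2"
  where "loc_map f = tensor_lift (\<lambda>a q. tens (f a) q)"

lemma loc_map_tens:
  assumes "\<And>a b. f (a + b) = f a + f b"
  shows "loc_map f (tens a q) = tens (f a) q"
  unfolding loc_map_def
  by (rule tensor_lift_tens) (simp add: biadditive_def assms tens_add_left tens_add_right)

text \<open>
  For an \<open>R\<close>-module \<open>M\<close> with scalar multiplication \<open>s\<close>, the action of \<open>R[1/2]\<close> on \<open>M[1/2]\<close>
  given by \<open>(r \<otimes> q) (m \<otimes> p) = r m \<otimes> q p\<close>, and its restriction to \<open>R\<close>.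
\<close>

definition loc_act ::
    "('r::comm_ring_1 \<Rightarrow> 'm::ab_group_add \<Rightarrow> 'm) \<Rightarrow> 'r loc2 \<Rightarrow> 'm loc2 \<Rightarrow> 'm loc2"
  where "loc_act s \<rho> = tensor_lift (\<lambda>m p. tensor_lift (\<lambda>r q. tens (s r m) (q * p)) \<rho>)"

definition loc_scale ::
    "('r::comm_ring_1 \<Rightarrow> 'm::ab_group_add \<Rightarrow> 'm) \<Rightarrow> 'r \<Rightarrow> 'm loc2 \<Rightarrow> 'm loc2"
  where "loc_scale s r = loc_act s (tens r 1)"

lemma loc_act_aux:
  assumes "module s"
  shows "biadditive (\<lambda>r (q :: dyadic). tens (s r m) (q * p))"
    and "biadditive (\<lambda>m (p :: dyadic). tensor_lift (\<lambda>r q. tens (s r m) (q * p)) \<rho>)"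
proof -
  interpret module s by fact
  show 1: "biadditive (\<lambda>r (q :: dyadic). tens (s r m) (q * p))" for m p
    by (simp add: biadditive_def scale_left_distrib tens_add_left tens_add_right distrib_right)
  have 0: "tensor_lift (\<lambda>r q. tens (s r m) (q * p)) 0 = 0" for m and p :: dyadic
    using tensor_lift_add[OF 1, of m p 0 0] by simp
  have "tensor_lift (\<lambda>r q. tens (s r (m + m')) (q * p)) \<rho> =
      tensor_lift (\<lambda>r q. tens (s r m) (q * p)) \<rho> + tensor_lift (\<lambda>r q. tens (s r m') (q * p)) \<rho>"
    for m m' and p :: dyadic
  proof (induction \<rho> rule: tensor_induct)
    case zero
    show ?case unfolding 0 by simp
  next
    case (add t a b)
    show ?case unfolding tensor_lift_add[OF 1] tensor_lift_tens[OF 1] add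
      by (simp add: scale_right_distrib tens_add_left)
  qed
  moreover have "tensor_lift (\<lambda>r q. tens (s r m) (q * (p + p'))) \<rho> =
      tensor_lift (\<lambda>r q. tens (s r m) (q * p)) \<rho> + tensor_lift (\<lambda>r q. tens (s r m) (q * p')) \<rho>"
    for m and p p' :: dyadic
  proof (induction \<rho> rule: tensor_induct)
    case zero
    show ?case unfolding 0 by simp
  next
    case (add t a b)
    show ?case unfolding tensor_lift_add[OF 1] tensor_lift_tens[OF 1] add
      by (simp add: distrib_left tens_add_right)
  qed
  ultimately show "biadditive (\<lambda>m p. tensor_lift (\<lambda>r q. tens (s r m) (q * p)) \<rho>)"
    by (simp add: biadditive_def)
qed

lemma loc_act_tens: "module s \<Longrightarrow> loc_act s (tens r q) (tens m p) = tens (s r m) (q * p)"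
  unfolding loc_act_def
  by (subst tensor_lift_tens, erule loc_act_aux(2), rule tensor_lift_tens, erule loc_act_aux(1))

lemma loc_act_add_right: "module s \<Longrightarrow> loc_act s \<rho> (t + u) = loc_act s \<rho> t + loc_act s \<rho> u"
  by (simp add: loc_act_def tensor_lift_add[OF loc_act_aux(2)])

lemma loc_act_zero_right: "module s \<Longrightarrow> loc_act s \<rho> 0 = 0"
  using loc_act_add_right[of s \<rho> 0 0] by simp

lemma loc_act_add_left:
  assumes "module s"
  shows "loc_act s (\<rho> + \<sigma>) t = loc_act s \<rho> t + loc_act s \<sigma> t"
proof (induction t rule: tensor_induct)
  case zero
  then show ?case by (simp add: loc_act_zero_right assms)
next
  case (add t a b)
  have "loc_act s (\<rho> + \<sigma>) (tens a b) = loc_act s \<rho> (tens a b) + loc_act s \<sigma> (tens a b)"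
    unfolding loc_act_def tensor_lift_tens[OF loc_act_aux(2)[OF assms]]
    by (rule tensor_lift_add[OF loc_act_aux(1)[OF assms]])
  with add show ?case by (simp add: loc_act_add_right[OF assms])
qed

lemma module_loc_scale:
  assumes "module s"
  shows "module (loc_scale s)"
proof -
  interpret module s by fact
  have scale_0: "loc_scale s r 0 = 0" for r
    by (simp add: loc_scale_def loc_act_zero_right assms)
  show ?thesis
  proof
    fix r r' :: 'a and x y :: "'b loc2"
    show "loc_scale s r (x + y) = loc_scale s r x + loc_scale s r y"
      by (simp add: loc_scale_def loc_act_add_right[OF assms])
    show "loc_scale s (r + r') x = loc_scale s r x + loc_scale s r' x"
      by (simp add: loc_scale_def loc_act_add_left[OF assms] tens_add_left)
    show "loc_scale s r (loc_scale s r' x) = loc_scale s (r * r') x"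
    proof (induction x rule: tensor_induct)
      case zero show ?case by (simp add: scale_0)
    next
      case (add t a b) then show ?case
        by (simp add: loc_scale_def loc_act_add_right[OF assms] loc_act_tens[OF assms])
    qed
    show "loc_scale s 1 x = x"
    proof (induction x rule: tensor_induct)
      case zero show ?case by (simp add: scale_0)
    next
      case (add t a b) then show ?case
        by (simp add: loc_scale_def loc_act_add_right[OF assms] loc_act_tens[OF assms])
    qed
  qed
qed


section \<open>Square classes and their integral group ring\<close>

text \<open>
  The group of square classes of the nonzero elements, as a partial quotient of the field.
  It is written additively (addition is induced by multiplication in the field), because
  the convolution product of \<^typ>\<open>'g \<Rightarrow>\<^sub>0 int\<close>, the group ring of \<open>'g\<close>, is based on \<open>(+)\<close>.
\<close>

definition same_sqclass :: "'a::field \<Rightarrow> 'a \<Rightarrow> bool"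
  where "same_sqclass x y \<longleftrightarrow> x \<noteq> 0 \<and> y \<noteq> 0 \<and> (\<exists>z. z \<noteq> 0 \<and> x = y * z ^ 2)"

quotient_type (overloaded) 'a sqclass = "'a::field" / partial: same_sqclass
proof (rule part_equivpI)
  show "\<exists>x :: 'a. same_sqclass x x"
    by (rule exI[of _ 1]) (auto simp: same_sqclass_def intro: exI[of _ 1])
  show "symp (same_sqclass :: 'a \<Rightarrow> _)"
  proof (rule sympI)
    fix x y :: 'a assume "same_sqclass x y"
    then obtain z where "x \<noteq> 0" "y \<noteq> 0" "z \<noteq> 0" "x = y * z ^ 2" by (auto simp: same_sqclass_def)
    then have "y = x * (inverse z) ^ 2" by (simp add: field_simps)
    then show "same_sqclass y x"
      unfolding same_sqclass_def using \<open>x \<noteq> 0\<close> \<open>y \<noteq> 0\<close> \<open>z \<noteq> 0\<close> nonzero_imp_inverse_nonzero by blast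
  qed
  show "transp (same_sqclass :: 'a \<Rightarrow> _)"
  proof (rule transpI)
    fix x y w :: 'a assume "same_sqclass x y" "same_sqclass y w"
    then obtain z z' where "x \<noteq> 0" "w \<noteq> 0" "z * z' \<noteq> 0" "x = w * (z * z') ^ 2"
      by (auto simp: same_sqclass_def power_mult_distrib mult_ac)
    then show "same_sqclass x w" unfolding same_sqclass_def by blast
  qed
qed

lemma same_sqclass_refl: "x \<noteq> 0 \<Longrightarrow> same_sqclass x x"
  by (auto simp: same_sqclass_def intro: exI[of _ 1])

lemma same_sqclass_mult:
  assumes "same_sqclass x x'" "same_sqclass y y'"
  shows "same_sqclass (x * y) (x' * y')"
proof -
  obtain z z' where "x = x' * z ^ 2" "y = y' * z' ^ 2" "z * z' \<noteq> 0"
    using assms by (auto simp: same_sqclass_def)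
  then have "x * y = x' * y' * (z * z') ^ 2" by (simp add: power_mult_distrib mult_ac)
  then show ?thesis
    using assms \<open>z * z' \<noteq> 0\<close> unfolding same_sqclass_def by (metis no_zero_divisors)
qed

instantiation sqclass :: (field) ab_group_add
begin
lift_definition zero_sqclass :: "'a sqclass" is 1
  by (rule same_sqclass_refl) simp
lift_definition plus_sqclass :: "'a sqclass \<Rightarrow> 'a sqclass \<Rightarrow> 'a sqclass" is "(*)"
  by (rule same_sqclass_mult)
lift_definition uminus_sqclass :: "'a sqclass \<Rightarrow> 'a sqclass" is inverse
proof -
  fix x y :: 'a assume "same_sqclass x y"
  then obtain z where *: "x \<noteq> 0" "y \<noteq> 0" "z \<noteq> 0" "x = y * z ^ 2" by (auto simp: same_sqclass_def)
  then have "inverse x = inverse y * (inverse z) ^ 2" by (simp add: field_simps)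
  then show "same_sqclass (inverse x) (inverse y)"
    unfolding same_sqclass_def using * nonzero_imp_inverse_nonzero by blast
qed
definition minus_sqclass :: "'a sqclass \<Rightarrow> 'a sqclass \<Rightarrow> 'a sqclass"
  where "minus_sqclass x y = x + - y"
instance
proof
  fix a b c :: "'a sqclass"
  show "a + b + c = a + (b + c)"
    by transfer (auto simp: same_sqclass_def mult_ac intro: exI[of _ 1])
  show "a + b = b + a"
    by transfer (auto simp: same_sqclass_def mult_ac intro: exI[of _ 1])
  show "0 + a = a"
    by transfer (auto simp: same_sqclass_def intro: exI[of _ 1])
  show "- a + a = 0"
    by transfer (auto simp: same_sqclass_def intro: exI[of _ 1])
  show "a - b = a + - b" by (rule minus_sqclass_def)
qed
end

type_synonym 'a sqring = "'a sqclass \<Rightarrow>\<^sub>0 int"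

text \<open>The elements \<open>\<langle>x\<rangle>\<close> and \<open>\<langle>\<langle>x\<rangle>\<rangle>\<close> of the group ring, meaningful for \<open>x \<noteq> 0\<close>.\<close>

text \<open>
  Otherwise \<open>lift_definition\<close> would unfold the coefficient ring of the modules below as well.
\<close>

lifting_forget sqclass.lifting
lifting_forget poly_mapping.lifting

definition sq :: "'a::field \<Rightarrow> 'a sqring"
  where "sq x = Poly_Mapping.single (abs_sqclass x) 1"

definition pf :: "'a::field \<Rightarrow> 'a sqring"
  where "pf x = sq x - 1"

definition aug_ideal :: "('a::field sqring) set"
  where "aug_ideal = {r. (\<Sum>g\<in>Poly_Mapping.keys r. Poly_Mapping.lookup r g) = 0}"

definition aug_ideal_sq :: "('a::field sqring) set"
  where "aug_ideal_sq = module.span (*) {r * s | r s. r \<in> aug_ideal \<and> s \<in> aug_ideal}"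

lemma sq_mult: "x \<noteq> 0 \<Longrightarrow> y \<noteq> 0 \<Longrightarrow> sq (x * y) = sq x * sq y"
  by (simp add: sq_def mult_single plus_sqclass.abs_eq same_sqclass_refl)

lemma sq_1 [simp]: "sq 1 = 1"
  by (simp add: sq_def zero_sqclass_def [symmetric])

lemma sq_square: "x \<noteq> 0 \<Longrightarrow> sq x * sq x = 1"
proof -
  assume x: "x \<noteq> 0"
  have "abs_sqclass (x * x) = abs_sqclass 1"
    by (rule Quotient3_rel_abs[OF Quotient3_sqclass])
      (use x in \<open>auto simp: same_sqclass_def power2_eq_square\<close>)
  then have "sq (x * x) = sq 1" by (simp add: sq_def)
  then show ?thesis using x by (simp add: sq_mult)
qed

lemma sq_inverse:
  assumes "x \<noteq> 0"
  shows "sq (inverse x) = sq x"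
proof -
  have "sq x * sq (inverse x) = 1"
    using assms by (simp flip: sq_mult)
  then have "sq x * sq x * sq (inverse x) = sq x"
    by (simp add: mult.assoc)
  then show ?thesis by (simp add: sq_square assms)
qed

lemma sq_divide: "x \<noteq> 0 \<Longrightarrow> y \<noteq> 0 \<Longrightarrow> sq (x / y) = sq x * sq y"
  by (simp add: divide_inverse sq_mult sq_inverse)

lemma pf_1 [simp]: "pf 1 = 0"
  by (simp add: pf_def)

lemma pf_in_aug_ideal: "pf x \<in> aug_ideal"
proof (cases "abs_sqclass x = 0")
  case True
  then show ?thesis by (simp add: pf_def sq_def aug_ideal_def)
next
  case False
  have "Poly_Mapping.keys (pf x) = {abs_sqclass x, 0}"
    using False by (auto simp: pf_def sq_def in_keys_iff lookup_minus lookup_single lookup_one when_def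
        split: if_splits)
  then show ?thesis
    using False by (simp add: aug_ideal_def pf_def sq_def lookup_minus lookup_single lookup_one)
qed


section \<open>Refined pre-Bloch groups\<close>

typedef (overloaded) 'a nzero = "{x :: 'a::field. x \<noteq> 0}"
  by (rule exI[of _ 1]) simp

type_synonym 'a free_nz = "'a nzero \<Rightarrow>\<^sub>0 'a sqring"

text \<open>The free generator attached to \<open>x \<noteq> 0\<close>.\<close>

definition nzgen :: "'a::field \<Rightarrow> 'a free_nz"
  where "nzgen x = free_gen (Abs_nzero x)"

definition five_term :: "'a::field \<Rightarrow> 'a \<Rightarrow> 'a free_nz"
  where "five_term x y =
    nzgen x - nzgen y + fscale (sq x) (nzgen (y / x))
      - fscale (sq (inverse x - 1)) (nzgen ((1 - inverse x) / (1 - inverse y)))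
      + fscale (sq (1 - x)) (nzgen ((1 - x) / (1 - y)))"

definition RP_rels :: "('a::field free_nz) set"
  where "RP_rels = {nzgen 1} \<union> {five_term x y | x y. x \<notin> {0, 1} \<and> y \<notin> {0, 1}}"

definition RPprime_rels :: "('a::field free_nz) set"
  where "RPprime_rels = RP_rels
    \<union> {fscale (sq (-1)) (nzgen x) - nzgen x | x. x \<noteq> 0}
    \<union> {nzgen x + nzgen (inverse x) | x. x \<noteq> 0}"

quotient_type (overloaded) 'a RP = "'a::field nzero \<Rightarrow>\<^sub>0 'a sqring" / "module_cong RP_rels"
  by (rule equivp_module_cong)

instantiation RP :: (field) ab_group_add
begin
lift_definition zero_RP :: "'a RP" is 0 .
lift_definition plus_RP :: "'a RP \<Rightarrow> 'a RP \<Rightarrow> 'a RP" is "(+)" by (rule module_cong_add)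
lift_definition minus_RP :: "'a RP \<Rightarrow> 'a RP \<Rightarrow> 'a RP" is "(-)" by (rule module_cong_diff)
lift_definition uminus_RP :: "'a RP \<Rightarrow> 'a RP" is uminus by (rule module_cong_uminus)
instance
  by standard (transfer, simp add: algebra_simps equivp_reflp[OF equivp_module_cong])+
end

lift_definition RP_scale :: "'a::field sqring \<Rightarrow> 'a RP \<Rightarrow> 'a RP" is fscale
  by (rule module_cong_scale)

lemma module_RP_scale: "module RP_scale"
  by (unfold_locales; transfer)
    (simp_all add: free.scale_right_distrib free.scale_left_distrib
      equivp_reflp[OF equivp_module_cong])

lift_definition RP_gen :: "'a::field \<Rightarrow> 'a RP" is nzgen .

quotient_type (overloaded) 'a RPprime =
    "'a::field nzero \<Rightarrow>\<^sub>0 'a sqring" / "module_cong RPprime_rels"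
  by (rule equivp_module_cong)

instantiation RPprime :: (field) ab_group_add
begin
lift_definition zero_RPprime :: "'a RPprime" is 0 .
lift_definition plus_RPprime :: "'a RPprime \<Rightarrow> 'a RPprime \<Rightarrow> 'a RPprime" is "(+)"
  by (rule module_cong_add)
lift_definition minus_RPprime :: "'a RPprime \<Rightarrow> 'a RPprime \<Rightarrow> 'a RPprime" is "(-)"
  by (rule module_cong_diff)
lift_definition uminus_RPprime :: "'a RPprime \<Rightarrow> 'a RPprime" is uminus
  by (rule module_cong_uminus)
instance
  by standard (transfer, simp add: algebra_simps equivp_reflp[OF equivp_module_cong])+
end

lift_definition RPprime_scale :: "'a::field sqring \<Rightarrow> 'a RPprime \<Rightarrow> 'a RPprime" is fscale
  by (rule module_cong_scale)

lemma module_RPprime_scale: "module RPprime_scale"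
  by (unfold_locales; transfer)
    (simp_all add: free.scale_right_distrib free.scale_left_distrib
      equivp_reflp[OF equivp_module_cong])

lift_definition RPprime_gen :: "'a::field \<Rightarrow> 'a RPprime" is nzgen .


section \<open>The map \<open>\<lambda>\<^sub>1\<close> and its kernel\<close>

definition lambda1_gen :: "'a::field nzero \<Rightarrow> 'a sqring"
  where "lambda1_gen u = (let x = Rep_nzero u in if x = 1 then 0 else pf (1 - x) * pf x)"

lemma module_mult: "module ((*) :: 'r::comm_ring_1 \<Rightarrow> 'r \<Rightarrow> 'r)"
  by unfold_locales (simp_all add: algebra_simps)

lemma free_lift_nzgen:
  "x \<noteq> 0 \<Longrightarrow> free_lift (*) lambda1_gen (nzgen x) = (if x = 1 then 0 else pf (1 - x) * pf x)"
  by (simp add: nzgen_def module_mult lambda1_gen_def Abs_nzero_inverse Let_def)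

lemma five_term_identity:
  fixes a b c d e :: "'r::comm_ring_1"
  assumes "a * a = 1" "b * b = 1" "c * c = 1" "d * d = 1" "e * e = 1"
  shows "(c - 1) * (a - 1) - (d - 1) * (b - 1) + a * ((e * a - 1) * (b * a - 1))
    - c * a * ((e * (a * d) - 1) * (c * b * (a * d) - 1))
    + c * ((e * d - 1) * (c * d - 1)) = 0"
proof -
  have [simp]: "a * (a * z) = z" "b * (b * z) = z" "c * (c * z) = z" "d * (d * z) = z"
    "e * (e * z) = z" for z
    by (simp_all add: assms mult.assoc [symmetric])
  show ?thesis by (simp add: assms algebra_simps)
qed

lemma lambda1_five_term:
  fixes x y :: "'a::field"
  assumes "x \<notin> {0, 1}" "y \<notin> {0, 1}"
  shows "free_lift (*) lambda1_gen (five_term x y) = 0"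
proof -
  interpret h: module_hom fscale "(*)" "free_lift (*) (lambda1_gen :: 'a nzero \<Rightarrow> _)"
    by (rule module_hom_free_lift[OF module_mult])
  have nz: "x \<noteq> 0" "y \<noteq> 0" "1 - x \<noteq> 0" "1 - y \<noteq> 0" "x \<noteq> 1" "y \<noteq> 1" "x - 1 \<noteq> 0" "y - 1 \<noteq> 0"
    using assms by auto
  have inv: "1 - inverse x \<noteq> 0" "1 - inverse y \<noteq> 0" using nz by (auto simp: field_simps)
  show ?thesis
  proof (cases "x = y")
    case True
    then show ?thesis
      using nz inv by (simp add: five_term_def h.add h.diff h.scale free_lift_nzgen)
  next
    case False
    then have e: "x - y \<noteq> 0" by simp
    have u1: "y / x \<noteq> 1" using False nz by (simp add: field_simps)
    have u3: "(1 - x) / (1 - y) \<noteq> 1" using False nz by (simp add: field_simps)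
    have v2: "(1 - inverse x) / (1 - inverse y) = ((1 - x) * y) / (x * (1 - y))"
      using nz inv by (simp add: divide_simps) (simp add: algebra_simps)
    have w1: "1 - y / x = (x - y) / x" using nz by (simp add: field_simps)
    have w3: "1 - (1 - x) / (1 - y) = (x - y) / (1 - y)" using nz by (simp add: field_simps)
    have w2: "1 - ((1 - x) * y) / (x * (1 - y)) = (x - y) / (x * (1 - y))"
      using nz by (simp add: field_simps)
    have u2: "((1 - x) * y) / (x * (1 - y)) \<noteq> 1" using w2 e nz by auto
    have i: "inverse x - 1 = (1 - x) / x" using nz by (simp add: field_simps)
    have nz': "y / x \<noteq> 0" "(1 - x) / (1 - y) \<noteq> 0" "((1 - x) * y) / (x * (1 - y)) \<noteq> 0"
      using nz by auto
    have "free_lift (*) lambda1_gen (five_term x y) =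
        pf (1 - x) * pf x - pf (1 - y) * pf y + sq x * (pf ((x - y) / x) * pf (y / x))
        - sq ((1 - x) / x) * (pf ((x - y) / (x * (1 - y))) * pf (((1 - x) * y) / (x * (1 - y))))
        + sq (1 - x) * (pf ((x - y) / (1 - y)) * pf ((1 - x) / (1 - y)))"
      unfolding five_term_def v2 i
      using nz nz' u1 u2 u3
      by (simp only: h.add h.diff h.scale free_lift_nzgen if_False not_False_eq_True w1 w2 w3)
    also have "\<dots> = 0"
      unfolding pf_def using nz e
      by (simp only: sq_divide sq_mult mult_eq_0_iff de_Morgan_disj simp_thms)
        (rule five_term_identity; simp add: sq_square)
    finally show ?thesis .
  qed
qed

lemma lambda1_RP_rels: "p \<in> RP_rels \<Longrightarrow> free_lift (*) lambda1_gen p = 0"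
  by (auto simp: RP_rels_def free_lift_nzgen lambda1_five_term)

lift_definition lambda1 :: "'a::field RP \<Rightarrow> 'a sqring" is "free_lift (*) lambda1_gen"
  by (rule free_lift_module_cong[OF module_mult lambda1_RP_rels])

lemma module_hom_lambda1: "module_hom RP_scale (*) lambda1"
proof -
  interpret h: module_hom fscale "(*)" "free_lift (*) (lambda1_gen :: 'a::field nzero \<Rightarrow> _)"
    by (rule module_hom_free_lift[OF module_mult])
  interpret module "RP_scale :: 'a sqring \<Rightarrow> _" by (rule module_RP_scale)
  show "module_hom RP_scale (*) (lambda1 :: 'a RP \<Rightarrow> _)"
    by unfold_locales (transfer, simp add: h.add h.scale)+
qed

lemma lambda1_RP_gen: "x \<noteq> 0 \<Longrightarrow> x \<noteq> 1 \<Longrightarrow> lambda1 (RP_gen x) = pf (1 - x) * pf x"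
  by transfer (simp add: free_lift_nzgen)

lemma lambda1_in_aug_ideal_sq: "lambda1 x \<in> aug_ideal_sq"
proof -
  interpret R: module "(*) :: 'a sqring \<Rightarrow> _" by (rule module_mult)
  have g: "lambda1_gen u \<in> aug_ideal_sq" for u :: "'a nzero"
    unfolding aug_ideal_sq_def lambda1_gen_def Let_def
    by (auto intro!: R.span_base R.span_zero pf_in_aug_ideal)
  show ?thesis
    by transfer (use g in \<open>auto simp: free_lift_def aug_ideal_sq_def intro!: R.span_sum R.span_scale\<close>)
qed

typedef (overloaded) 'a RP1 = "{x :: 'a::field RP. lambda1 x = 0}"
proof -
  interpret module_hom RP_scale "(*)" "lambda1 :: 'a RP \<Rightarrow> _" by (rule module_hom_lambda1)
  show ?thesis by (rule exI[of _ 0]) simp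
qed

setup_lifting type_definition_RP1

instantiation RP1 :: (field) ab_group_add
begin
lift_definition zero_RP1 :: "'a RP1" is 0
  by (rule module_hom.zero[OF module_hom_lambda1])
lift_definition plus_RP1 :: "'a RP1 \<Rightarrow> 'a RP1 \<Rightarrow> 'a RP1" is "(+)"
  by (simp add: module_hom.add[OF module_hom_lambda1])
lift_definition minus_RP1 :: "'a RP1 \<Rightarrow> 'a RP1 \<Rightarrow> 'a RP1" is "(-)"
  by (simp add: module_hom.diff[OF module_hom_lambda1])
lift_definition uminus_RP1 :: "'a RP1 \<Rightarrow> 'a RP1" is uminus
  by (simp add: module_hom.neg[OF module_hom_lambda1])
instance
  by standard (transfer, simp add: algebra_simps)+
end

lift_definition RP1_scale :: "'a::field sqring \<Rightarrow> 'a RP1 \<Rightarrow> 'a RP1" is RP_scale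
  by (simp add: module_hom.scale[OF module_hom_lambda1])

lemma module_RP1_scale: "module RP1_scale"
proof -
  interpret module "RP_scale :: 'a::field sqring \<Rightarrow> _" by (rule module_RP_scale)
  show "module (RP1_scale :: 'a sqring \<Rightarrow> _)"
    by unfold_locales (transfer, simp add: scale_right_distrib scale_left_distrib)+
qed


section \<open>The comparison map\<close>

definition psi1 :: "'a::field \<Rightarrow> 'a RP"
  where "psi1 x = RP_gen x + RP_scale (sq (-1)) (RP_gen (inverse x))"

definition e_plus :: "'a::field sqring loc2"
  where "e_plus = tens (1 + sq (-1)) half"

text \<open>
  The prescribed values lie in \<open>RP(F)[1/2]\<close>, so the values of a map into \<open>RP\<^sub>1(F)[1/2]\<close> are
  compared with them along the map induced by the inclusion of \<open>RP\<^sub>1(F)\<close> into \<open>RP(F)\<close>.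
\<close>

definition comparison_hom :: "('a::field RPprime loc2 \<Rightarrow> 'a RP1 loc2) \<Rightarrow> bool"
  where "comparison_hom \<phi> \<longleftrightarrow>
    module_hom (loc_scale RPprime_scale) (loc_scale RP1_scale) \<phi> \<and>
    \<phi> (tens (RPprime_gen 1) 1) = 0 \<and>
    (\<forall>x. x \<noteq> 0 \<and> x \<noteq> 1 \<longrightarrow>
      loc_map Rep_RP1 (\<phi> (tens (RPprime_gen x) 1)) =
        loc_act RP_scale e_plus (tens (RP_gen x) 1)
        + loc_act RP_scale (tens (pf (1 - x)) half) (tens (psi1 x) 1))"

end

theory Submission
  imports Defs
begin

text \<open>
  The inverse of the comparison map is the map induced by the quotient map from \<open>RP\<close> to \<open>RP'\<close>,
  restricted to the kernel of \<open>\<lambda>\<^sub>1\<close>.  After inverting 2, \<open>RP\<close> splits into the parts on which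
  \<open>\<langle>-1\<rangle>\<close> acts as \<open>1\<close> and as \<open>-1\<close>.

  On the \<open>-1\<close>-part, \<open>\<psi>\<^sub>1\<close> vanishes, since its cocycle property gives both \<open>\<psi>\<^sub>1(-x) = \<psi>\<^sub>1(x)\<close> and
  \<open>\<psi>\<^sub>1(-x) = -\<psi>\<^sub>1(x)\<close>; the five-term relation then yields \<open>\<langle>x\<rangle>[x] = \<langle>1-x\<rangle>[x] = -[x]\<close> and
  \<open>\<lambda>\<^sub>1([y])[x] = \<lambda>\<^sub>1([x])[y]\<close>.  As \<open>\<lambda>\<^sub>1([x])[x] = 4[x]\<close>, the map \<open>\<lambda>\<^sub>1\<close> is injective there.

  On the \<open>1\<close>-part, the cocycle \<open>\<psi>\<^sub>1\<close> depends on square classes only, so it extends to an additive map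
  \<open>\<Psi>\<close> on the group ring with \<open>\<Psi>(r\<langle>\<langle>x\<rangle>\<rangle>) = r \<psi>\<^sub>1(x)\<close>.  The map \<open>\<theta>(m) = m + \<Psi>(\<lambda>\<^sub>1 m) / 2\<close> kills the
  relations of \<open>RP'\<close> and is the identity on the kernel of \<open>\<lambda>\<^sub>1\<close>; so the quotient map is injective there.
  It is surjective because \<open>\<theta>([x])\<close> lies in the kernel of \<open>\<lambda>\<^sub>1\<close> and maps to \<open>[x]'\<close>.

  All of this is carried out integrally, up to 2-power torsion, which is exactly what dies in \<open>A[1/2]\<close>.
\<close>

section \<open>The kernel and image of localisation at two\<close>

interpretation int_mod: module "int_scale :: int \<Rightarrow> 'a::ab_group_add \<Rightarrow> 'a"
  by (rule module_int_scale)

lemma additive_zero: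
  fixes f :: "'a::ab_group_add \<Rightarrow> 'b::ab_group_add"
  assumes "\<And>a b. f (a + b) = f a + f b"
  shows "f 0 = 0"
  using assms[of 0 0] by simp

lemma additive_int_scale:
  fixes f :: "'a::ab_group_add \<Rightarrow> 'b::ab_group_add"
  assumes add: "\<And>a b. f (a + b) = f a + f b"
  shows "f (int_scale k a) = int_scale k (f a)"
proof (induction k rule: int_induct[where k = 0])
  case base
  then show ?case by (simp add: additive_zero[OF add])
next
  case (step1 i)
  then show ?case by (simp add: int_mod.scale_left_distrib add)
next
  case (step2 i)
  have "f (int_scale (i - 1) a) + f a = f (int_scale i a)"
    unfolding add [symmetric] by (simp add: int_mod.scale_left_diff_distrib)
  then show ?case using step2 by (simp add: int_mod.scale_left_diff_distrib algebra_simps)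
qed

lemma tens_int_scale_left: "tens (int_scale k a) b = int_scale k (tens a b)"
  by (rule additive_int_scale[where f = "\<lambda>a. tens a b"]) (rule tens_add_left)

lemma tens_int_scale_right: "tens a (int_scale k b) = int_scale k (tens a b)"
  by (rule additive_int_scale[where f = "tens a"]) (rule tens_add_right)

lemma int_scale_ring: "int_scale k (r :: 'r::ring_1) = of_int k * r"
proof (induction k rule: int_induct[where k = 0])
  case base
  show ?case by simp
qed (simp_all add: int_mod.scale_left_distrib int_mod.scale_left_diff_distrib algebra_simps)

lemma two_half: "2 * half = 1"
  unfolding one_add_one[symmetric] by transfer simp

lemma two_pow_half_pow: "2 ^ n * half ^ n = 1"
  unfolding power_mult_distrib [symmetric] two_half by simp

lemma dyadic_cases:
  obtains k n where "(q :: dyadic) = of_int k * half ^ n"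
proof -
  have Rep_of_int: "Rep_dyadic (of_int k) = of_int k" for k
  proof (induction k rule: int_induct[where k = 0])
    case base show ?case by (simp add: zero_dyadic.rep_eq)
  qed (simp_all add: plus_dyadic.rep_eq minus_dyadic.rep_eq one_dyadic.rep_eq)
  have Rep_half: "Rep_dyadic (half ^ n) = 1 / 2 ^ n" for n
    by (induction n) (simp_all add: times_dyadic.rep_eq one_dyadic.rep_eq half.rep_eq)
  obtain k n where "Rep_dyadic q = of_int k / 2 ^ n" using Rep_dyadic[of q] by auto
  then have "Rep_dyadic q = Rep_dyadic (of_int k * half ^ n)"
    by (simp add: times_dyadic.rep_eq Rep_of_int Rep_half)
  then have "q = of_int k * half ^ n" by (simp only: Rep_dyadic_inject)
  then show ?thesis by (rule that)
qed

lemma int_scale_pow_half: "int_scale (2 ^ n) (half ^ (n + m)) = half ^ m"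
proof -
  have "int_scale (2 ^ n) (half ^ (n + m)) = (2 ^ n * half ^ n) * half ^ m"
    by (simp add: int_scale_ring power_add mult.assoc)
  then show ?thesis by (simp only: two_pow_half_pow mult_1)
qed

lemma tens_shift: "tens a (half ^ m) = tens (int_scale (2 ^ n) a) (half ^ (n + m))"
  unfolding tens_int_scale_left tens_int_scale_right [symmetric] int_scale_pow_half ..

text \<open>Every dyadic number is an integer multiple of a power of \<open>half\<close>; the
  integer moves into the left factor, and \<open>tens_shift\<close> puts two summands over a common
  denominator.\<close>

lemma loc2_cases:
  obtains a n where "(t :: 'a::ab_group_add loc2) = tens a (half ^ n)"
proof -
  have "\<exists>a n. t = tens a (half ^ n)"
  proof (induction t rule: tensor_induct)
    case zero
    show ?case by (metis tens_zero_left)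
  next
    case (add t a q)
    then obtain b n where t: "t = tens b (half ^ n)" by blast
    obtain k m where q: "q = of_int k * half ^ m" by (rule dyadic_cases)
    have "tens a q = tens (int_scale k a) (half ^ m)"
      by (simp add: q tens_int_scale_left flip: tens_int_scale_right int_scale_ring)
    then have "t + tens a q = tens (int_scale (2 ^ m) b + int_scale (2 ^ n) (int_scale k a)) (half ^ (m + n))"
      using t tens_shift[of b n m] tens_shift[of "int_scale k a" m n]
      by (simp add: tens_add_left add.commute)
    then show ?case by blast
  qed
  then show ?thesis using that by blast
qed

text \<open>Multiplying the dyadic factor by \<open>half ^ n\<close> undoes multiplication by
  \<open>2 ^ n\<close>.\<close>

lemma int_scale_pow_cancel:
  fixes t :: "'a::ab_group_add loc2"
  assumes "int_scale (2 ^ n) t = 0"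
  shows "t = 0"
proof -
  define H where "H = (tensor_lift (\<lambda>a q. tens a (half ^ n * q)) :: 'a loc2 \<Rightarrow> 'a loc2)"
  have bi: "biadditive (\<lambda>(a :: 'a) q. tens a (half ^ n * q))"
    by (simp add: biadditive_def tens_add_left tens_add_right distrib_left)
  obtain a m where t: "t = tens a (half ^ m)" by (rule loc2_cases)
  have "int_scale (2 ^ n) t = tens a (2 ^ n * half ^ m)"
    by (simp add: t int_scale_ring flip: tens_int_scale_right)
  moreover have "half ^ n * (2 ^ n * half ^ m) = half ^ m"
    unfolding mult.assoc [symmetric] mult.commute[of "half ^ n"] two_pow_half_pow by simp
  ultimately have "H (int_scale (2 ^ n) t) = t"
    by (simp add: H_def tensor_lift_tens[OF bi] t)
  then show ?thesis
    using assms additive_zero[of H] tensor_lift_add[OF bi] by (simp add: H_def)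
qed

lemma loc2_no_two_torsion: "t + t = 0 \<Longrightarrow> t = (0 :: 'a::ab_group_add loc2)"
  using int_scale_pow_cancel[of 1 t] int_mod.scale_left_distrib[of 1 1 t] by simp

text \<open>For the harder direction, membership in the span of the bilinearity relations is tested
  by maps \<open>F n\<close> back into the group itself.\<close>

lemma tens_eq_zero_iff: "tens a (half ^ m) = 0 \<longleftrightarrow> (\<exists>k. int_scale (2 ^ k) a = 0)"
proof
  assume "\<exists>k. int_scale (2 ^ k) a = 0"
  then show "tens a (half ^ m) = 0" using tens_shift[of a m] by (metis tens_zero_left)
next
  assume "tens a (half ^ m) = 0"
  then have "int_scale (2 ^ m) (tens a (half ^ m)) = 0" by simp
  then have "tens a (1 :: dyadic) = 0"
    using int_scale_pow_half[of m 0] by (simp flip: tens_int_scale_right)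
  then have "module_cong tensor_rels (free_gen (a, 1 :: dyadic)) 0"
    by (simp add: tens_def zero_tensor_def tensor.abs_eq_iff)
  then have span: "free_gen (a, 1 :: dyadic) \<in> free.span tensor_rels"
    by (simp add: module_cong_def)
  txt \<open>
    On dyadic numbers with denominator dividing \<open>2 ^ n\<close>, the floor is exact, so \<open>(a, q) \<mapsto> 2 ^ n q a\<close>
    is biadditive there; a relation involves finitely many denominators.
  \<close>
  define e where "e n q = \<lfloor>2 ^ n * Rep_dyadic q\<rfloor>" for n q
  define F where "F n = free_lift int_scale (\<lambda>(a :: 'a, q). int_scale (e n q) a)" for n
  have F: "module_hom fscale int_scale (F n)" for n
    unfolding F_def by (rule module_hom_free_lift[OF module_int_scale])
  have F_gen: "F n (free_gen (b, q)) = int_scale (e n q) b" for n b q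
    by (simp add: F_def module_int_scale)
  have ev_add: "\<exists>N. \<forall>n\<ge>N. e n (q + q') = e n q + e n q'" for q q'
  proof -
    obtain c :: int and i :: nat where c: "Rep_dyadic q = of_int c / 2 ^ i" using Rep_dyadic[of q] by auto
    \<comment> \<open>One integral summand already makes the floor additive, so the denominator of
      \<open>q\<close> alone bounds \<open>n\<close>.\<close>
    have "e n (q + q') = e n q + e n q'" if n: "n \<ge> i" for n
    proof -
      obtain d where d: "n = i + d" using n le_Suc_ex by blast
      have int: "2 ^ n * Rep_dyadic q = of_int (2 ^ d * c)" by (simp add: c d power_add)
      have "2 ^ n * Rep_dyadic (q + q') = 2 ^ n * Rep_dyadic q + 2 ^ n * Rep_dyadic q'"
        by (simp add: plus_dyadic.rep_eq distrib_left)
      then show ?thesis unfolding e_def by (simp only: int floor_of_int int_add_floor)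
    qed
    then show ?thesis by blast
  qed
  have base: "\<exists>N. \<forall>n\<ge>N. F n p = 0" if p: "p \<in> tensor_rels" for p
  proof -
    consider (l) b b' q where "p = free_gen (b + b', q) - free_gen (b, q) - free_gen (b', q)"
      | (r) b q q' where "p = free_gen (b, q + q') - free_gen (b, q) - free_gen (b, q')"
      using p by (auto simp: tensor_rels_def)
    then show ?thesis
    proof cases
      case l
      then show ?thesis by (simp add: module_hom.diff[OF F] F_gen int_mod.scale_right_distrib)
    next
      case r
      obtain N where "\<forall>n\<ge>N. e n (q + q') = e n q + e n q'" using ev_add by blast
      then have "\<forall>n\<ge>N. F n p = 0"
        by (simp add: r module_hom.diff[OF F] F_gen int_mod.scale_left_distrib)
      then show ?thesis by blast
    qed
  qed
  \<comment> \<open>Vanishing for all large \<open>n\<close>, rather than for a single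
    \<open>n\<close>, passes to finite sums.\<close>
  have "\<exists>N. \<forall>n\<ge>N. F n (free_gen (a, 1)) = 0"
    using span
  proof (induction rule: free.span_induct_alt)
    case base
    then show ?case by (simp add: module_hom.zero[OF F])
  next
    case (step c x y)
    then obtain N N' where "\<forall>n\<ge>N. F n x = 0" "\<forall>n\<ge>N'. F n y = 0" using base by blast
    then have "\<forall>n\<ge>max N N'. F n (fscale c x + y) = 0"
      by (simp add: module_hom.add[OF F] module_hom.scale[OF F])
    then show ?case by blast
  qed
  then obtain n where "int_scale (e n 1) a = 0" unfolding F_gen by blast
  then show "\<exists>k. int_scale (2 ^ k) a = 0"
    by (auto simp: e_def one_dyadic.rep_eq)
qed

lemma loc_map_add:
  assumes "\<And>a b. f (a + b) = f a + f b"
  shows "loc_map f (t + u) = loc_map f t + loc_map f u"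
  unfolding loc_map_def
  by (rule tensor_lift_add) (simp add: biadditive_def assms tens_add_left tens_add_right)

lemma additive_inj:
  fixes f :: "'a::ab_group_add \<Rightarrow> 'b::ab_group_add"
  assumes add: "\<And>a b. f (a + b) = f a + f b" and "\<And>a. f a = 0 \<Longrightarrow> a = 0"
  shows "inj f"
proof (rule injI)
  fix x y assume "f x = f y"
  moreover have "f (x - y) + f y = f x" unfolding add [symmetric] by simp
  ultimately have "f (x - y) = 0" by simp
  then show "x = y" using assms(2)[of "x - y"] by simp
qed

text \<open>The numerator of an element of the kernel is sent by \<open>f\<close> to 2-power
  torsion, so a power of 2 times it lies in the kernel of \<open>f\<close>.\<close>

lemma inj_loc_map:
  assumes add: "\<And>a b. f (a + b) = f a + f b"
    and ker: "\<And>a. f a = 0 \<Longrightarrow> \<exists>k. int_scale (2 ^ k) a = 0"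
  shows "inj (loc_map f)"
proof (rule additive_inj)
  show "loc_map f (t + u) = loc_map f t + loc_map f u" for t u
    by (rule loc_map_add[OF add])
next
  fix t assume 0: "loc_map f t = 0"
  obtain a m where t: "t = tens a (half ^ m)" by (rule loc2_cases)
  then have "tens (f a) (half ^ m) = 0" using 0 loc_map_tens[of f, OF add] by simp
  then obtain k where "f (int_scale (2 ^ k) a) = 0"
    by (auto simp: tens_eq_zero_iff additive_int_scale[of f, OF add])
  then obtain j where "int_scale (2 ^ (j + k)) a = 0"
    using ker[of "int_scale (2 ^ k) a"] by (auto simp: power_add)
  then show "t = 0" unfolding t tens_eq_zero_iff by blast
qed

lemma surj_loc_map:
  fixes f :: "'a::ab_group_add \<Rightarrow> 'b::ab_group_add"
  assumes add: "\<And>a b. f (a + b) = f a + f b"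
    and im: "\<And>b. \<exists>k a. f a = int_scale (2 ^ k) b"
  shows "surj (loc_map f)"
proof (unfold surj_def, intro allI)
  fix t :: "'b loc2"
  obtain b m where t: "t = tens b (half ^ m)" by (rule loc2_cases)
  obtain k a where "f a = int_scale (2 ^ k) b" using im by blast
  then have "loc_map f (tens a (half ^ (k + m))) = t"
    using tens_shift[of b m k] loc_map_tens[of f, OF add] by (simp add: t)
  then show "\<exists>u. t = loc_map f u" by blast
qed

text \<open>Clearing the denominator of an argument loses nothing, because powers of 2 cancel in the
  target.\<close>

lemma loc2_additive_eqI:
  fixes \<phi> \<psi> :: "'a::ab_group_add loc2 \<Rightarrow> 'b::ab_group_add loc2"
  assumes "\<And>t u. \<phi> (t + u) = \<phi> t + \<phi> u" "\<And>t u. \<psi> (t + u) = \<psi> t + \<psi> u"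
    and eq: "\<And>a. \<phi> (tens a 1) = \<psi> (tens a 1)"
  shows "\<phi> = \<psi>"
proof
  fix t :: "'a loc2"
  obtain a n where t: "t = tens a (half ^ n)" by (rule loc2_cases)
  have "int_scale (2 ^ n) t = tens a 1"
    using int_scale_pow_half[of n 0] by (simp add: t flip: tens_int_scale_right)
  then have "int_scale (2 ^ n) (\<phi> t) = int_scale (2 ^ n) (\<psi> t)"
    using eq[of a] additive_int_scale[of \<phi>, OF assms(1)] additive_int_scale[of \<psi>, OF assms(2)]
    by metis
  then show "\<phi> t = \<psi> t"
    using int_scale_pow_cancel[of n "\<phi> t - \<psi> t"] by (simp add: int_mod.scale_right_diff_distrib)
qed

lemma loc_scale_tens: "module s \<Longrightarrow> loc_scale s r (tens a q) = tens (s r a) q"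
  by (simp add: loc_scale_def loc_act_tens)

lemma module_hom_loc_map:
  assumes f: "module_hom s s' f"
  shows "module_hom (loc_scale s) (loc_scale s') (loc_map f)"
proof -
  interpret f: module_hom s s' f by fact
  interpret L: module "loc_scale s" by (rule module_loc_scale[OF f.m1.module_axioms])
  interpret L': module "loc_scale s'" by (rule module_loc_scale[OF f.m2.module_axioms])
  show ?thesis
  proof
    show "loc_map f (t + u) = loc_map f t + loc_map f u" for t u
      by (rule loc_map_add) (rule f.add)
    show "loc_map f (loc_scale s r t) = loc_scale s' r (loc_map f t)" for r t
      by (cases t rule: loc2_cases)
        (simp add: loc_scale_tens f.m1.module_axioms f.m2.module_axioms loc_map_tens f.add f.scale)
  qed
qed

section \<open>Modules satisfying the five-term relation\<close>

text \<open>Here the bound of four elements enters: \<open>psi_self\<close> needs a point away from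
  three given ones.\<close>

lemma ex_field_avoid:
  assumes "infinite (UNIV :: 'a::field set) \<or> 4 \<le> card (UNIV :: 'a set)"
  shows "\<exists>z :: 'a. z \<notin> {0, 1, u}"
proof (rule ccontr)
  assume "\<not> ?thesis"
  then have *: "(UNIV :: 'a set) \<subseteq> {0, 1, u}" by blast
  then have "finite (UNIV :: 'a set)" by (rule finite_subset) simp
  moreover have "card (UNIV :: 'a set) \<le> card {0, 1, u}" by (rule card_mono[OF _ *]) simp
  moreover have "card {0, 1, u} \<le> 3" by (simp add: card_insert_if)
  ultimately show False using assms by simp
qed

lemma sq_minus: "x \<noteq> 0 \<Longrightarrow> sq (- x) = sq (-1) * sq x"
  using sq_mult[of "-1" x] by simp

lemma sq_square_left: "x \<noteq> 0 \<Longrightarrow> sq x * (sq x * r) = r"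
  by (simp add: sq_square mult.assoc [symmetric])

lemma sq_inverse_diff_one:
  assumes "x \<noteq> 0" "x \<noteq> 1"
  shows "sq (inverse x - 1) = sq x * sq (1 - x)"
proof -
  have "inverse x - 1 = (1 - x) / x" using assms by (simp add: field_simps)
  then show ?thesis using assms by (simp add: sq_divide mult.commute)
qed

lemma sq_one_diff_inverse:
  assumes "x \<noteq> 0" "x \<noteq> 1"
  shows "sq (1 - inverse x) = sq (-1) * sq x * sq (1 - x)"
proof -
  have "inverse x - 1 \<noteq> 0" using assms by (simp add: field_simps)
  then have "sq (- (inverse x - 1)) = sq (-1) * (sq x * sq (1 - x))"
    using assms by (simp add: sq_minus[of "inverse x - 1"] sq_inverse_diff_one del: minus_diff_eq)
  then show ?thesis by (simp add: mult.assoc)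
qed

text \<open>This is the value of \<open>lambda1\<close> at the generator of \<open>x\<close>, at
  \<open>x = 1\<close> too since \<open>pf 1 = 0\<close>.\<close>

definition symb :: "'a::field \<Rightarrow> 'a sqring"
  where "symb x = pf (1 - x) * pf x"

lemma symb_one: "symb 1 = 0"
  by (simp add: symb_def)

lemma symb_sq:
  assumes "x \<notin> {0, 1}"
  shows "symb x * sq x = - symb x" "symb x * sq (1 - x) = - symb x"
  using assms sq_square[of x] sq_square[of "1 - x"] by (simp_all add: symb_def pf_def algebra_simps sq_square_left)

text \<open>With the terms kept opaque, this and the next two lemmas combine two five-term relations
  for \<open>psi_diff\<close>, \<open>gen_one_minus\<close> and \<open>h_five\<close>.\<close>

lemma cancel_five:
  fixes a b c d e a' b' c' :: "'m::ab_group_add"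
  assumes "a - b + c - d + e = 0" "a' - b' + c' - e + d = 0"
  shows "b + b' = (a + a') + (c + c')"
proof -
  have "(a - b + c - d + e) + (a' - b' + c' - e + d) = 0"
    using assms by simp
  then show ?thesis by (simp add: algebra_simps)
qed

lemma cancel_five_diff:
  fixes a b c d e a' b' :: "'m::ab_group_add"
  assumes "a - b + c - d + e = 0" "a' - b' + e - d + c = 0"
  shows "a - b - a' + b' = 0"
proof -
  have "(a - b + c - d + e) - (a' - b' + e - d + c) = 0"
    using assms by simp
  then show ?thesis by (simp add: algebra_simps)
qed

lemma cancel_five_swap:
  fixes a b c d e c' d' e' :: "'m::ab_group_add"
  assumes "a - b + c - d + e = 0" "b - a + c' - d' + e' = 0"
  shows "(c' + c) - (d' + d) + (e' + e) = 0"
proof -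
  have "(a - b + c - d + e) + (b - a + c' - d' + e') = 0"
    using assms by simp
  then show ?thesis by (simp add: algebra_simps)
qed

text \<open>Instantiated by \<open>RP\<close> itself and by an image of it in its
  localisation.\<close>

locale five_term_module = module s
  for s :: "'a::field sqring \<Rightarrow> 'm::ab_group_add \<Rightarrow> 'm" (infixr \<open>\<cdot>\<close> 75) +
  fixes g :: "'a \<Rightarrow> 'm"
  assumes gen_one: "g 1 = 0"
    and five: "x \<notin> {0, 1} \<Longrightarrow> y \<notin> {0, 1} \<Longrightarrow>
      g x - g y + sq x \<cdot> g (y / x) - sq (inverse x - 1) \<cdot> g ((1 - inverse x) / (1 - inverse y))
        + sq (1 - x) \<cdot> g ((1 - x) / (1 - y)) = 0"
    and large: "infinite (UNIV :: 'a set) \<or> 4 \<le> card (UNIV :: 'a set)"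
begin

definition psi :: "'a \<Rightarrow> 'm"
  where "psi x = g x + sq (-1) \<cdot> g (inverse x)"

lemma psi_one: "psi 1 = 0"
  by (simp add: psi_def gen_one)

lemma psi_inverse: "psi (inverse x) = sq (-1) \<cdot> psi x"
  by (simp add: psi_def scale_right_distrib sq_square)

text \<open>Add to the relation at \<open>(x, y)\<close> the one at the inverses, multiplied by
  \<open>sq (-1)\<close>: the terms in \<open>u\<close> and \<open>v\<close> exchange roles and
  cancel.\<close>

lemma psi_diff:
  assumes x: "x \<notin> {0, 1}" and y: "y \<notin> {0, 1}"
  shows "psi y = psi x + sq x \<cdot> psi (y / x)"
proof -
  have nz: "x \<noteq> 0" "x \<noteq> 1" "1 - x \<noteq> 0" "y \<noteq> 0" using assms by auto
  define u where "u = (1 - inverse x) / (1 - inverse y)"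
  define v where "v = (1 - x) / (1 - y)"
  have "g x - g y + sq x \<cdot> g (y / x) - (sq x * sq (1 - x)) \<cdot> g u + sq (1 - x) \<cdot> g v = 0"
    using five[OF x y] nz by (simp add: sq_inverse_diff_one u_def v_def)
  moreover have "inverse y / inverse x = inverse (y / x)"
    by (simp add: field_simps)
  then have "g (inverse x) - g (inverse y) + sq x \<cdot> g (inverse (y / x))
      - (sq (-1) * sq (1 - x)) \<cdot> g v + (sq (-1) * sq x * sq (1 - x)) \<cdot> g u = 0"
    using five[of "inverse x" "inverse y"] x y nz sq_minus[of "1 - x"]
    by (simp add: sq_one_diff_inverse sq_inverse u_def v_def)
  then have "sq (-1) \<cdot> (g (inverse x) - g (inverse y) + sq x \<cdot> g (inverse (y / x))
      - (sq (-1) * sq (1 - x)) \<cdot> g v + (sq (-1) * sq x * sq (1 - x)) \<cdot> g u) = 0"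
    by simp
  then have "sq (-1) \<cdot> g (inverse x) - sq (-1) \<cdot> g (inverse y)
      + sq x \<cdot> sq (-1) \<cdot> g (inverse (y / x)) - sq (1 - x) \<cdot> g v + (sq x * sq (1 - x)) \<cdot> g u = 0"
    by (simp add: scale_right_distrib scale_right_diff_distrib sq_square_left mult.assoc
        mult.commute[of "sq (-1)" "sq x"] mult.left_commute[of "sq x" "sq (-1)"])
  ultimately have "g y + sq (-1) \<cdot> g (inverse y) = (g x + sq (-1) \<cdot> g (inverse x))
     + (sq x \<cdot> g (y / x) + sq x \<cdot> sq (-1) \<cdot> g (inverse (y / x)))"
    by (rule cancel_five)
  then show ?thesis
    by (simp only: psi_def scale_right_distrib)
qed

text \<open>Going from \<open>z * u\<close> to \<open>z\<close> and back by \<open>psi_diff\<close>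
  relates \<open>psi u\<close> to \<open>psi (inverse u)\<close>. The choice of \<open>z\<close>
  keeps both points away from 0 and 1.\<close>

lemma psi_self:
  assumes "u \<noteq> 0"
  shows "sq u \<cdot> sq (-1) \<cdot> psi u = - psi u"
proof (cases "u = 1")
  case True then show ?thesis by (simp add: psi_one)
next
  case False
  obtain z where z: "z \<notin> {0, 1, inverse u}" using ex_field_avoid[OF large] by blast
  let ?x = "z * u"
  have x: "?x \<notin> {0, 1}" using z assms by (auto simp: field_simps)
  have "psi z = psi ?x + sq ?x \<cdot> psi (z / ?x)" "psi ?x = psi z + sq z \<cdot> psi (?x / z)"
    using psi_diff x z by blast+
  moreover have "z / ?x = inverse u" "?x / z = u" using z by (auto simp: field_simps)
  ultimately have "psi z = psi z + sq z \<cdot> psi u + sq ?x \<cdot> sq (-1) \<cdot> psi u"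
    by (simp only: psi_inverse)
  then have "sq ?x \<cdot> sq (-1) \<cdot> psi u + sq z \<cdot> psi u = 0"
    by (simp only: add.assoc add.commute) simp
  then have "sq z \<cdot> (sq ?x \<cdot> sq (-1) \<cdot> psi u + sq z \<cdot> psi u) = 0" by simp
  then have "sq u \<cdot> sq (-1) \<cdot> psi u + psi u = 0"
    using z assms by (simp add: scale_right_distrib sq_mult sq_square sq_square_left mult.assoc)
  then show ?thesis by (simp add: eq_neg_iff_add_eq_0)
qed

text \<open>The cocycle rule on all units: the case \<open>x * y = 1\<close>, which
  \<open>psi_diff\<close> leaves out, is \<open>psi_self\<close>.\<close>

lemma psi_mult:
  assumes "x \<noteq> 0" "y \<noteq> 0"
  shows "psi (x * y) = psi x + sq x \<cdot> psi y"
proof (cases "x = 1")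
  case True then show ?thesis by (simp add: psi_one)
next
  case x: False
  show ?thesis
  proof (cases "x * y = 1")
    case True
    then have "y = inverse x" by (metis inverse_unique)
    then show ?thesis using assms psi_self[of x] by (simp add: psi_one psi_inverse)
  next
    case False
    then show ?thesis using psi_diff[of x "x * y"] x assms by simp
  qed
qed

text \<open>The factor \<open>1 + sq (-1)\<close> is twice the idempotent of the 1-part, so this is
  an integral form of the projected cocycle.\<close>

definition psip :: "'a \<Rightarrow> 'm"
  where "psip x = (1 + sq (-1)) \<cdot> psi x"

lemma psip_self:
  assumes "x \<noteq> 0"
  shows "sq x \<cdot> psip x = - psip x"
proof -
  have "sq x \<cdot> psip x = (1 + sq (-1)) \<cdot> sq x \<cdot> sq (-1) \<cdot> psi x"
    by (simp add: psip_def algebra_simps sq_square_left sq_square)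
  then show ?thesis by (simp only: psi_self[OF assms] psip_def scale_minus_right)
qed

lemma psip_mult:
  assumes "x \<noteq> 0" "y \<noteq> 0"
  shows "psip (x * y) = psip x + sq x \<cdot> psip y"
  unfolding psip_def psi_mult[OF assms] by (simp only: scale_right_distrib scale_scale mult.commute)

text \<open>On a square, \<open>psip_mult\<close> and \<open>psip_self\<close> give
  \<open>psip z - psip z\<close>.\<close>

lemma psip_same_sqclass:
  assumes "same_sqclass x y"
  shows "psip x = psip y"
proof -
  obtain z where z: "x = y * (z * z)" "y \<noteq> 0" "z \<noteq> 0"
    using assms by (auto simp: same_sqclass_def power2_eq_square)
  have "psip (z * z) = 0" using psip_mult[of z z] psip_self[of z] z by simp
  then show ?thesis using psip_mult[of y "z * z"] z by simp
qed

end

section \<open>The part on which \<open>sq (-1)\<close> acts as -1\<close>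

locale minus_five_term_module = five_term_module s g
  for s :: "'a::field sqring \<Rightarrow> 'm::ab_group_add \<Rightarrow> 'm" (infixr \<open>\<cdot>\<close> 75) and g :: "'a \<Rightarrow> 'm" +
  assumes minus_one_act: "x \<noteq> 0 \<Longrightarrow> sq (-1) \<cdot> g x = - g x"
    and no_two_torsion: "t + t = 0 \<Longrightarrow> t = (0 :: 'm)"
begin

lemma eq_neg_imp_zero: "t = - t \<Longrightarrow> t = (0 :: 'm)"
  using no_two_torsion[of t] by (metis add.right_inverse)

lemma psi_zero:
  assumes "x \<noteq> 0"
  shows "psi x = 0"
proof -
  have 1: "psi (-1) = 0" by (simp add: psi_def minus_one_act)
  have 2: "sq (-1) \<cdot> psi x = - psi x"
    using assms by (simp add: psi_def minus_one_act scale_right_diff_distrib)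
  have "psi (- x) = psi x" using psi_mult[of x "-1"] assms 1 by simp
  moreover have "psi (- x) = - psi x" using psi_mult[of "-1" x] assms 1 2 by simp
  ultimately show ?thesis by (intro eq_neg_imp_zero) simp
qed

lemma gen_inverse: "x \<noteq> 0 \<Longrightarrow> g (inverse x) = g x"
  using psi_zero[of x] by (simp add: psi_def minus_one_act)

text \<open>In this form, swapping \<open>x\<close> and \<open>y\<close> inverts the three
  quotients; passing to \<open>1 - x\<close> and \<open>1 - y\<close> also inverts them and
  exchanges the first with the last.\<close>

lemma five_reduced:
  assumes x: "x \<notin> {0, 1}" and y: "y \<notin> {0, 1}"
  shows "g x - g y + sq x \<cdot> g (y / x) - (sq x * sq (1 - x)) \<cdot> g ((y * (1 - x)) / (x * (1 - y)))
        + sq (1 - x) \<cdot> g ((1 - x) / (1 - y)) = 0"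
proof -
  have "(1 - inverse x) / (1 - inverse y) = (y * (1 - x)) / (x * (1 - y))"
    using x y by (auto simp: divide_simps) (auto simp: algebra_simps)
  then show ?thesis using five[OF x y] x by (simp add: sq_inverse_diff_one)
qed

text \<open>Comparing the relations at \<open>(x, y)\<close> and \<open>(1 - x, 1 - y)\<close> shows
  that \<open>g x - g (1 - x)\<close> does not depend on \<open>x\<close>; at
  \<open>y = 1 - x\<close> it becomes its own negative.\<close>

lemma gen_one_minus:
  assumes x: "x \<notin> {0, 1}"
  shows "g (1 - x) = g x"
proof -
  have *: "g x - g y - g (1 - x) + g (1 - y) = 0" if y: "y \<notin> {0, 1}" for y
  proof -
    let ?u = "(y * (1 - x)) / (x * (1 - y))" and ?v = "(1 - x) / (1 - y)"
    have "g (x / y) = g (y / x)" "g (x * (1 - y) / (y * (1 - x))) = g ?u" "g ((1 - y) / (1 - x)) = g ?v"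
      using gen_inverse[of "y / x"] gen_inverse[of ?u] gen_inverse[of ?v] x y by auto
    then have "g (1 - x) - g (1 - y) + sq (1 - x) \<cdot> g ?v - (sq x * sq (1 - x)) \<cdot> g ?u
        + sq x \<cdot> g (y / x) = 0"
      using five_reduced[of "1 - x" "1 - y"] x y by (simp add: mult.commute)
    with five_reduced[OF x y] show ?thesis by (rule cancel_five_diff)
  qed
  have "g x - g (1 - x) = - (g x - g (1 - x))"
    using *[of "1 - x"] x by (simp add: algebra_simps)
  then have "g x - g (1 - x) = 0" by (rule eq_neg_imp_zero)
  then show ?thesis by simp
qed

text \<open>The defect of the identity \<open>sq x \<cdot> g x = - g x\<close>.\<close>

definition h :: "'a \<Rightarrow> 'm"
  where "h x = sq x \<cdot> g x + g x"

lemma minus_one_act_h: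
  assumes "x \<noteq> 0"
  shows "sq (-1) \<cdot> h x = - h x"
  by (simp only: h_def scale_right_distrib scale_left_commute[of "sq (-1)" "sq x"]
      minus_one_act[OF assms] scale_minus_right minus_add_distrib)

lemma h_minus_one: "h (-1) = 0"
  by (simp add: h_def minus_one_act)

text \<open>The five-term relations for \<open>(x, y)\<close> and \<open>(y, x)\<close> involve the same three quotients up to inversion.\<close>

lemma h_five:
  assumes x: "x \<notin> {0, 1}" and y: "y \<notin> {0, 1}"
  shows "sq x \<cdot> h (y / x) - (sq x * sq (1 - x)) \<cdot> h ((y * (1 - x)) / (x * (1 - y)))
    + sq (1 - x) \<cdot> h ((1 - x) / (1 - y)) = 0"
proof -
  let ?w = "y / x" and ?u = "(y * (1 - x)) / (x * (1 - y))" and ?v = "(1 - x) / (1 - y)"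
  have nz: "x \<noteq> 0" "1 - x \<noteq> 0" "y \<noteq> 0" "1 - y \<noteq> 0" using x y by auto
  have inv: "g (x / y) = g ?w" "g (x * (1 - y) / (y * (1 - x))) = g ?u" "g ((1 - y) / (1 - x)) = g ?v"
    using gen_inverse[of ?w] gen_inverse[of ?u] gen_inverse[of ?v] nz by auto
  have "(sq y \<cdot> g ?w + sq x \<cdot> g ?w) - ((sq y * sq (1 - y)) \<cdot> g ?u + (sq x * sq (1 - x)) \<cdot> g ?u)
      + (sq (1 - y) \<cdot> g ?v + sq (1 - x) \<cdot> g ?v) = 0"
    using five_reduced[OF x y] five_reduced[OF y x] unfolding inv by (rule cancel_five_swap)
  moreover have "sq x * sq ?w = sq y" "sq (1 - x) * sq ?v = sq (1 - y)"
    "sq x * sq (1 - x) * sq ?u = sq y * sq (1 - y)"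
    using nz by (simp_all add: sq_divide sq_mult mult_ac sq_square_left)
  ultimately show ?thesis
    unfolding h_def scale_right_distrib scale_scale
    by simp
qed

lemma h_zero:
  assumes w: "w \<noteq> 0" "w \<noteq> 1"
  shows "h w = 0"
proof (cases "(2 :: 'a) = 0")
  case True
  \<comment> \<open>In characteristic 2 the class of -1 is trivial, so it acts both as 1 and as
    -1.\<close>
  then have "(-1 :: 'a) = 1" by (metis add.inverse_unique one_add_one)
  then have "sq (-1 :: 'a) = 1" by (metis sq_1)
  then have "g w = - g w" using minus_one_act[of w] w by simp
  then have "g w = 0" by (rule eq_neg_imp_zero)
  then show ?thesis by (simp add: h_def)
next
  case two: False
  show ?thesis
  proof (cases "w = -1")
    case True then show ?thesis by (simp add: h_minus_one)
  next
    case False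
    have p: "1 + w \<noteq> 0" using False by (metis add.inverse_unique)
    have q: "1 - w \<noteq> 0" using w by simp
    txt \<open>
      Both choices make one of the three quotients equal to \<open>-1\<close>; the results differ by the
      factor \<open>\<langle>-1\<rangle>\<close>, which acts as \<open>-1\<close>.
    \<close>
    have A: "h w = sq (1 - w) \<cdot> sq (1 + w) \<cdot> h (- w)"
    proof -
      \<comment> \<open>For the pair \<open>?x\<close>, \<open>- ?x\<close> the first quotient is
        -1; this \<open>?x\<close> solves \<open>(1 - x) / (1 + x) = w\<close>, so the last quotient
        is \<open>w\<close> and the middle one \<open>- w\<close>.\<close>
      let ?x = "(1 - w) / (1 + w)"
      have x1: "1 - ?x = 2 * w / (1 + w)" and x2: "1 + ?x = 2 / (1 + w)"
        using p by (simp_all add: field_simps)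
      have nz: "?x \<noteq> 0" "1 - ?x \<noteq> 0" "1 + ?x \<noteq> 0"
        unfolding x1 x2 using p q w two by auto
      have aux: "(2 * w / c) / (2 / c) = w" "(- (d / c) * (2 * w / c)) / ((d / c) * (2 / c)) = - w"
        if "c \<noteq> 0" "d \<noteq> 0" for c d
        using that two by (simp_all add: field_simps)
      have e: "(1 - ?x) / (1 - - ?x) = w" "(- ?x * (1 - ?x)) / (?x * (1 - - ?x)) = - w"
        using aux[OF p q] unfolding diff_minus_eq_add x1 x2 by auto
      have "?x \<noteq> 1" using nz(2) by (metis diff_self)
      moreover have "- ?x \<noteq> 1" using nz(3) by (metis add.right_inverse minus_minus add.commute)
      ultimately have "?x \<notin> {0, 1}" "- ?x \<notin> {0, 1}" using nz(1) by simp_all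
      from h_five[OF this] have "sq ?x \<cdot> h (- ?x / ?x) - (sq ?x * sq (1 - ?x)) \<cdot> h (- w)
          + sq (1 - ?x) \<cdot> h w = 0"
        unfolding e .
      moreover have "- ?x / ?x = -1" using nz(1) by (metis divide_self minus_divide_left)
      ultimately have "sq (1 - ?x) \<cdot> h w = (sq ?x * sq (1 - ?x)) \<cdot> h (- w)"
        by (simp only: h_minus_one) simp
      then have "sq (1 - ?x) \<cdot> sq (1 - ?x) \<cdot> h w = sq (1 - ?x) \<cdot> (sq ?x * sq (1 - ?x)) \<cdot> h (- w)"
        by simp
      moreover have "sq (1 - ?x) * (sq ?x * sq (1 - ?x)) = sq ?x"
        using sq_square_left[OF nz(2), of "sq ?x"] by (simp only: mult_ac)
      ultimately have "h w = sq ?x \<cdot> h (- w)"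
        by (simp only: scale_scale sq_square[OF nz(2)] scale_one)
      then show ?thesis using p q by (simp add: sq_divide)
    qed
    have B: "h w = sq (-1) \<cdot> sq (1 - w) \<cdot> sq (1 + w) \<cdot> h (- w)"
    proof -
      \<comment> \<open>The solution of \<open>y = w * x\<close> and \<open>x + y = 2\<close>; the
        second equation says that the last quotient is -1.\<close>
      let ?x = "2 / (1 + w)"
      let ?y = "2 * w / (1 + w)"
      have x1: "1 - ?x = - ((1 - w) / (1 + w))" and y1: "1 - ?y = (1 - w) / (1 + w)"
        using p by (simp_all add: field_simps)
      have nz: "?x \<noteq> 0" "1 - ?x \<noteq> 0" "?y \<noteq> 0" "1 - ?y \<noteq> 0"
        unfolding x1 y1 using p q w two by auto
      have aux: "(2 * w / c) / (2 / c) = w" "((2 * w / c) * - (d / c)) / (2 / c * (d / c)) = - w"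
        "- (d / c) / (d / c) = -1" if "c \<noteq> 0" "d \<noteq> 0" for c d
        using that two by (simp_all add: field_simps)
      have e: "?y / ?x = w" "(?y * (1 - ?x)) / (?x * (1 - ?y)) = - w" "(1 - ?x) / (1 - ?y) = -1"
        unfolding x1 y1 by (rule aux[OF p q])+
      have "?x \<noteq> 1" "?y \<noteq> 1" using nz(2,4) by (metis diff_self)+
      then have "?x \<notin> {0, 1}" "?y \<notin> {0, 1}" using nz(1,3) by simp_all
      from h_five[OF this] have "sq ?x \<cdot> h w - (sq ?x * sq (1 - ?x)) \<cdot> h (- w) = 0"
        unfolding e h_minus_one by simp
      then have "sq ?x \<cdot> sq ?x \<cdot> h w = sq ?x \<cdot> sq ?x \<cdot> sq (1 - ?x) \<cdot> h (- w)"
        by simp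
      then have "h w = sq (1 - ?x) \<cdot> h (- w)"
        using nz by (simp add: sq_square sq_square_left)
      moreover have "sq (1 - ?x) = sq (-1) * (sq (1 - w) * sq (1 + w))"
        unfolding x1 using sq_minus[of "(1 - w) / (1 + w)"] p q by (simp add: sq_divide)
      ultimately show ?thesis by simp
    qed
    have "h w = sq (-1) \<cdot> h w" using A B by simp
    also have "\<dots> = - h w" using w by (simp add: minus_one_act_h)
    finally show ?thesis by (rule eq_neg_imp_zero)
  qed
qed

lemma act_self:
  assumes "x \<notin> {0, 1}"
  shows "sq x \<cdot> g x = - g x" "sq (1 - x) \<cdot> g x = - g x"
proof -
  have *: "sq z \<cdot> g z = - g z" if "z \<notin> {0, 1}" for z
    using h_zero[of z] that by (simp add: h_def eq_neg_iff_add_eq_0)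
  show "sq x \<cdot> g x = - g x" using * assms by blast
  show "sq (1 - x) \<cdot> g x = - g x" using *[of "1 - x"] gen_one_minus[of x] assms by auto
qed

lemma four_scale: "4 \<cdot> t = (t + t) + (t + t)"
proof -
  have "4 \<cdot> t = ((1 + 1) + (1 + 1)) \<cdot> t" by simp
  then show ?thesis by (simp only: scale_left_distrib scale_one)
qed

text \<open>By \<open>act_self\<close>, each of the two factors of \<open>symb x\<close> acts on
  \<open>g x\<close> as -2.\<close>

lemma symb_self:
  assumes "x \<noteq> 0"
  shows "symb x \<cdot> g x = 4 \<cdot> g x"
proof (cases "x = 1")
  case True then show ?thesis by (simp add: symb_one gen_one)
next
  case False
  then show ?thesis using act_self[of x] assms
    by (simp add: symb_def pf_def four_scale algebra_simps flip: scale_scale)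
qed

text \<open>On \<open>c \<cdot> g z\<close> the class \<open>sq z\<close> acts as 1 by assumption
  and as -1 by \<open>act_self\<close>.\<close>

lemma gen_cancel:
  assumes "z \<noteq> 0" "c * sq z = c"
  shows "c \<cdot> g z = 0"
proof (cases "z = 1")
  case True then show ?thesis by (simp add: gen_one)
next
  case False
  then have "c \<cdot> sq z \<cdot> g z = - (c \<cdot> g z)" using act_self(1)[of z] assms by simp
  then show ?thesis using assms by (intro eq_neg_imp_zero) simp
qed

lemma four_cancel: "4 \<cdot> t = 0 \<Longrightarrow> t = 0"
  unfolding four_scale using no_two_torsion by metis

text \<open>Multiply the five-term relation by \<open>symb x * symb y\<close>, on which each of the
  classes of \<open>x\<close>, \<open>1 - x\<close>, \<open>y\<close>, \<open>1 - y\<close> acts as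
  -1. The quotients involve an even number of these, so \<open>gen_cancel\<close> removes their
  terms.\<close>

lemma symb_exchange:
  assumes "x \<noteq> 0" "y \<noteq> 0"
  shows "symb y \<cdot> g x = symb x \<cdot> g y"
proof (cases "x = 1 \<or> y = 1")
  case True then show ?thesis by (auto simp: symb_one gen_one)
next
  case False
  then have x: "x \<notin> {0, 1}" and y: "y \<notin> {0, 1}" using assms by auto
  let ?w = "y / x" and ?u = "(y * (1 - x)) / (x * (1 - y))" and ?v = "(1 - x) / (1 - y)"
  define P where "P = symb x * symb y"
  have nz: "x \<noteq> 0" "1 - x \<noteq> 0" "y \<noteq> 0" "1 - y \<noteq> 0" using x y by auto
  have PP: "P * sq x = - P" "P * sq (1 - x) = - P" "P * sq y = - P" "P * sq (1 - y) = - P"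
    unfolding P_def using symb_sq[OF x] symb_sq[OF y]
    by (metis mult.assoc mult.commute mult_minus_left)+
  have P': "P * (sq x * r) = - (P * r)" "P * (sq (1 - x) * r) = - (P * r)"
    "P * (sq y * r) = - (P * r)" "P * (sq (1 - y) * r) = - (P * r)" for r
    by (simp_all only: PP mult.assoc [symmetric] mult_minus_left)
  have z: "P \<cdot> g ?w = 0" "P \<cdot> g ?u = 0" "P \<cdot> g ?v = 0"
    using nz by (intro gen_cancel; simp add: sq_divide sq_mult PP P' mult.assoc)+
  have "P \<cdot> (g x - g y + sq x \<cdot> g ?w - (sq x * sq (1 - x)) \<cdot> g ?u + sq (1 - x) \<cdot> g ?v) = 0"
    by (simp only: five_reduced[OF x y] scale_zero_right)
  then have "P \<cdot> g x = P \<cdot> g y"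
    by (simp add: scale_right_distrib scale_right_diff_distrib PP P' z mult.assoc)
  then have "symb y \<cdot> symb x \<cdot> g x = symb x \<cdot> symb y \<cdot> g y" by (simp add: P_def mult.commute)
  then have "symb y \<cdot> 4 \<cdot> g x = symb x \<cdot> 4 \<cdot> g y" by (simp only: symb_self[OF nz(1)] symb_self[OF nz(3)])
  then have "4 \<cdot> (symb y \<cdot> g x - symb x \<cdot> g y) = 0"
    by (simp add: scale_right_diff_distrib mult.commute)
  then show ?thesis using four_cancel by fastforce
qed

lemma symb_injective:
  assumes A: "finite A" "\<And>i. i \<in> A \<Longrightarrow> x i \<noteq> 0" and l: "(\<Sum>i\<in>A. r i * symb (x i)) = 0"
  shows "(\<Sum>i\<in>A. r i \<cdot> g (x i)) = 0"
proof -
  define m where "m = (\<Sum>i\<in>A. r i \<cdot> g (x i))"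
  \<comment> \<open>By \<open>symb_exchange\<close> this is the vanishing sum of the hypothesis,
    acting on \<open>g (x j)\<close>.\<close>
  have lm: "symb (x j) \<cdot> m = 0" if "j \<in> A" for j
  proof -
    have "symb (x j) \<cdot> m = (\<Sum>i\<in>A. r i \<cdot> symb (x j) \<cdot> g (x i))"
      by (simp add: m_def scale_sum_right mult.commute)
    also have "\<dots> = (\<Sum>i\<in>A. (r i * symb (x i)) \<cdot> g (x j))"
      using A that by (intro sum.cong refl) (metis symb_exchange scale_scale)
    also have "\<dots> = 0" using l by (simp flip: scale_sum_left)
    finally show ?thesis .
  qed
  txt \<open>The product of the \<open>4 - symb (x j)\<close> kills every generator of \<open>m\<close>, but acts on \<open>m\<close> as a power of 4.\<close>
  have "B \<subseteq> A \<longrightarrow> (\<Prod>j\<in>B. 4 - symb (x j)) \<cdot> m = 4 ^ card B \<cdot> m" if "finite B" for B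
    using that
  proof (induction B)
    case empty then show ?case by simp
  next
    case (insert j B)
    show ?case
    proof
      assume "insert j B \<subseteq> A"
      with insert.IH have IH: "(\<Prod>j\<in>B. 4 - symb (x j)) \<cdot> m = 4 ^ card B \<cdot> m"
        and j: "symb (x j) \<cdot> m = 0" using lm by auto
      have "(\<Prod>j\<in>insert j B. 4 - symb (x j)) \<cdot> m = (4 - symb (x j)) \<cdot> (\<Prod>j\<in>B. 4 - symb (x j)) \<cdot> m"
        using insert.hyps by simp
      also have "\<dots> = 4 ^ card B \<cdot> (4 - symb (x j)) \<cdot> m"
        unfolding IH by (rule scale_left_commute)
      also have "\<dots> = 4 ^ card B \<cdot> 4 \<cdot> m"
        using j by (simp only: scale_left_diff_distrib diff_zero)
      finally show "(\<Prod>j\<in>insert j B. 4 - symb (x j)) \<cdot> m = 4 ^ card (insert j B) \<cdot> m"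
        using insert.hyps by (simp add: mult.commute)
    qed
  qed
  moreover have "(\<Prod>j\<in>A. 4 - symb (x j)) \<cdot> g (x i) = 0" if "i \<in> A" for i
  proof -
    have "(\<Prod>j\<in>A. 4 - symb (x j)) = (\<Prod>j\<in>A - {i}. 4 - symb (x j)) * (4 - symb (x i))"
      using A that by (simp add: prod.remove mult.commute)
    then show ?thesis using symb_self[of "x i"] A that
      by (simp add: scale_left_diff_distrib flip: scale_scale)
  qed
  then have "(\<Prod>j\<in>A. 4 - symb (x j)) \<cdot> m = 0"
    by (simp add: m_def scale_sum_right mult.commute[of _ "r _"] flip: scale_scale[of "r _"])
  ultimately have "4 ^ card A \<cdot> m = 0" using A by simp
  moreover have "4 ^ n \<cdot> m = 0 \<longrightarrow> m = 0" for n
    by (induction n) (auto simp flip: scale_scale dest: four_cancel)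
  ultimately show ?thesis by (simp add: m_def)
qed

end

section \<open>Extending the cocycle additively to the group ring\<close>

lemma free_expansion:
  "p = (\<Sum>b\<in>Poly_Mapping.keys p. fscale (Poly_Mapping.lookup p b) (free_gen b))"
  by (rule poly_mapping_eqI)
    (auto simp: lookup_sum free_gen_def lookup_single when_def in_keys_iff
      if_distrib[of "(*) _"] cong: if_cong)

lemma free_hom_eq_lift:
  assumes "module_hom fscale s f"
  shows "f p = free_lift s (\<lambda>b. f (free_gen b)) p"
proof -
  interpret module_hom fscale s f by fact
  have "f p = f (\<Sum>b\<in>Poly_Mapping.keys p. fscale (Poly_Mapping.lookup p b) (free_gen b))"
    by (rule arg_cong[OF free_expansion])
  then show ?thesis by (simp only: free_lift_def sum scale)
qed

lemma free_induct:
  assumes "P 0" "\<And>p r b. P p \<Longrightarrow> P (p + fscale r (free_gen b))"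
  shows "P p"
proof -
  have "P (\<Sum>b\<in>A. fscale (Poly_Mapping.lookup p b) (free_gen b))" if "finite A" for A
    using that
  proof (induction A)
    case empty
    then show ?case using assms(1) by simp
  next
    case (insert b A)
    then show ?case using assms(2)[OF insert.IH] by (simp add: add.commute)
  qed
  from this[of "Poly_Mapping.keys p"] show ?thesis
    unfolding free_expansion [symmetric] by simp
qed

lemma fscale_int: "fscale k p = int_scale k p"
proof (induction k rule: int_induct[where k = 0])
  case base
  show ?case by simp
qed (simp_all add: int_mod.scale_left_distrib int_mod.scale_left_diff_distrib
    free.scale_left_distrib free.scale_left_diff_distrib)

lemma abs_sqclass_cases:
  obtains x where "x \<noteq> 0" "c = abs_sqclass x"
proof
  have "same_sqclass (rep_sqclass c) (rep_sqclass c)"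
    by (rule Quotient3_rep_reflp[OF Quotient3_sqclass])
  then show "rep_sqclass c \<noteq> 0" by (simp add: same_sqclass_def)
  show "c = abs_sqclass (rep_sqclass c)"
    by (rule Quotient3_abs_rep[OF Quotient3_sqclass, symmetric])
qed

lemma sq_free_gen: "sq x = free_gen (abs_sqclass x)"
  by (simp add: sq_def free_gen_def)

lemma sqring_additive_eqI:
  fixes f h :: "'a::field sqring \<Rightarrow> 'm::ab_group_add"
  assumes f: "\<And>r s. f (r + s) = f r + f s" and h: "\<And>r s. h (r + s) = h r + h s"
    and eq: "\<And>x. x \<noteq> 0 \<Longrightarrow> f (sq x) = h (sq x)"
  shows "f r = h r"
proof (induction r rule: free_induct)
  case 1
  show ?case using additive_zero[of f, OF f] additive_zero[of h, OF h] by simp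
next
  case (2 p k c)
  obtain x where "x \<noteq> 0" "c = abs_sqclass x" by (rule abs_sqclass_cases)
  then have "f (free_gen c) = h (free_gen c)" using eq[of x] by (simp add: sq_free_gen)
  then show ?case
    using 2 by (simp add: f h fscale_int additive_int_scale[of f, OF f] additive_int_scale[of h, OF h])
qed

context five_term_module
begin

text \<open>By \<open>psip_same_sqclass\<close> the chosen representatives do not matter.\<close>

definition Psi :: "'a sqring \<Rightarrow> 'm"
  where "Psi = free_lift int_scale (\<lambda>c. psip (rep_sqclass c))"

lemma Psi_add: "Psi (r + r') = Psi r + Psi r'"
  unfolding Psi_def by (rule module_hom.add[OF module_hom_free_lift[OF module_int_scale]])

lemma Psi_sq:
  assumes "x \<noteq> 0"
  shows "Psi (sq x) = psip x"
proof -
  have "same_sqclass (rep_sqclass (abs_sqclass x)) x"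
    by (rule Quotient3_rep_abs[OF Quotient3_sqclass same_sqclass_refl[OF assms]])
  then show ?thesis
    by (simp add: Psi_def sq_free_gen module_int_scale psip_same_sqclass)
qed

text \<open>On a group element \<open>sq a\<close> this is the cocycle rule, in the form
  \<open>psip (a * x) - psip a\<close>.\<close>

lemma Psi_pf:
  assumes "x \<noteq> 0"
  shows "Psi (r * pf x) = r \<cdot> psip x"
proof (rule sqring_additive_eqI)
  show "Psi ((r + r') * pf x) = Psi (r * pf x) + Psi (r' * pf x)" for r r'
    by (simp add: distrib_right Psi_add)
  show "(r + r') \<cdot> psip x = r \<cdot> psip x + r' \<cdot> psip x" for r r'
    by (rule scale_left_distrib)
  fix a :: 'a assume a: "a \<noteq> 0"
  have "sq (a * x) = sq a * pf x + sq a"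
    using a assms by (simp add: pf_def sq_mult algebra_simps)
  then have "Psi (sq (a * x)) = Psi (sq a * pf x) + Psi (sq a)" by (simp only: Psi_add)
  then show "Psi (sq a * pf x) = sq a \<cdot> psip x"
    using a assms by (simp add: Psi_sq psip_mult)
qed

lemma hom_image:
  assumes "module_hom s s' f"
  shows "five_term_module s' (\<lambda>x. f (g x))"
proof -
  interpret f: module_hom s s' f by fact
  show ?thesis
  proof
    show "f (g 1) = 0" by (simp add: gen_one)
    fix x y :: 'a assume "x \<notin> {0, 1}" "y \<notin> {0, 1}"
    from arg_cong[OF five[OF this], of f]
    show "f (g x) - f (g y) + s' (sq x) (f (g (y / x)))
        - s' (sq (inverse x - 1)) (f (g ((1 - inverse x) / (1 - inverse y))))
        + s' (sq (1 - x)) (f (g ((1 - x) / (1 - y)))) = 0"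
      by (simp only: f.add f.diff f.scale f.zero)
  qed (rule large)
qed

end

section \<open>The pre-Bloch groups and their kernels\<close>

interpretation RP_mod: module RP_scale
  by (rule module_RP_scale)

interpretation RPprime_mod: module RPprime_scale
  by (rule module_RPprime_scale)

interpretation lambda1: module_hom RP_scale "(*)" lambda1
  by (rule module_hom_lambda1)

interpretation abs_RP: module_hom fscale RP_scale abs_RP
  by unfold_locales (simp_all add: plus_RP.abs_eq RP_scale.abs_eq)

interpretation abs_RPprime: module_hom fscale RPprime_scale abs_RPprime
  by unfold_locales (simp_all add: plus_RPprime.abs_eq RPprime_scale.abs_eq)

lemma free_gen_nzgen: "free_gen u = nzgen (Rep_nzero u)"
  by (simp add: nzgen_def Rep_nzero_inverse)

lemma Rep_nzero_nonzero: "Rep_nzero u \<noteq> 0"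
  using Rep_nzero[of u] by simp

lemma RP_gen_abs: "RP_gen x = abs_RP (nzgen x)"
  by (simp add: RP_gen.abs_eq)

lemma RPprime_gen_abs: "RPprime_gen x = abs_RPprime (nzgen x)"
  by (simp add: RPprime_gen.abs_eq)

lemma abs_RP_eq_0_iff: "abs_RP p = 0 \<longleftrightarrow> p \<in> free.span RP_rels"
  unfolding zero_RP_def RP.abs_eq_iff module_cong_def by simp

lemma abs_RPprime_eq_0_iff: "abs_RPprime p = 0 \<longleftrightarrow> p \<in> free.span RPprime_rels"
  unfolding zero_RPprime_def RPprime.abs_eq_iff module_cong_def by simp

lemma RP_induct:
  assumes "P 0" "\<And>m r x. x \<noteq> 0 \<Longrightarrow> P m \<Longrightarrow> P (m + RP_scale r (RP_gen x))"
  shows "P m"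
proof -
  have "P (abs_RP p)" for p
    by (induction p rule: free_induct)
      (simp_all add: assms(1) abs_RP.add abs_RP.scale free_gen_nzgen Rep_nzero_nonzero assms(2)
        flip: RP_gen_abs)
  then show ?thesis by (induction m) auto
qed

lemma RPprime_induct:
  assumes "P 0" "\<And>m r x. x \<noteq> 0 \<Longrightarrow> P m \<Longrightarrow> P (m + RPprime_scale r (RPprime_gen x))"
  shows "P m"
proof -
  have "P (abs_RPprime p)" for p
    by (induction p rule: free_induct)
      (simp_all add: assms(1) abs_RPprime.add abs_RPprime.scale free_gen_nzgen Rep_nzero_nonzero
        assms(2) flip: RPprime_gen_abs)
  then show ?thesis by (induction m) auto
qed

lemma RP_gen_one: "RP_gen 1 = 0"
  unfolding RP_gen_abs abs_RP_eq_0_iff by (rule free.span_base) (simp add: RP_rels_def)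

lemma RPprime_rel: "p \<in> RPprime_rels \<Longrightarrow> abs_RPprime p = 0"
  unfolding abs_RPprime_eq_0_iff by (rule free.span_base)

lemma RPprime_gen_one: "RPprime_gen 1 = 0"
  unfolding RPprime_gen_abs by (rule RPprime_rel) (simp add: RPprime_rels_def RP_rels_def)

lemma RPprime_minus_one:
  assumes "x \<noteq> 0"
  shows "RPprime_scale (sq (-1)) (RPprime_gen x) = RPprime_gen x"
proof -
  have "abs_RPprime (fscale (sq (-1)) (nzgen x) - nzgen x) = 0"
    by (rule RPprime_rel) (use assms in \<open>auto simp: RPprime_rels_def\<close>)
  then show ?thesis by (simp add: RPprime_gen_abs abs_RPprime.diff abs_RPprime.scale)
qed

lemma RPprime_inverse:
  assumes "x \<noteq> 0"
  shows "RPprime_gen x + RPprime_gen (inverse x) = 0"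
proof -
  have "abs_RPprime (nzgen x + nzgen (inverse x)) = 0"
    by (rule RPprime_rel) (use assms in \<open>auto simp: RPprime_rels_def\<close>)
  then show ?thesis by (simp add: RPprime_gen_abs abs_RPprime.add)
qed

lemma five_term_module_RP:
  assumes "infinite (UNIV :: 'a::field set) \<or> 4 \<le> card (UNIV :: 'a set)"
  shows "five_term_module RP_scale (RP_gen :: 'a \<Rightarrow> 'a RP)"
proof
  show "RP_gen (1 :: 'a) = 0" by (rule RP_gen_one)
  fix x y :: 'a assume "x \<notin> {0, 1}" "y \<notin> {0, 1}"
  then have "five_term x y \<in> RP_rels" by (auto simp: RP_rels_def)
  then have "abs_RP (five_term x y) = 0" unfolding abs_RP_eq_0_iff by (rule free.span_base)
  then show "RP_gen x - RP_gen y + RP_scale (sq x) (RP_gen (y / x))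
      - RP_scale (sq (inverse x - 1)) (RP_gen ((1 - inverse x) / (1 - inverse y)))
      + RP_scale (sq (1 - x)) (RP_gen ((1 - x) / (1 - y))) = 0"
    by (simp only: five_term_def abs_RP.add abs_RP.diff abs_RP.scale RP_gen_abs)
qed (rule assms)

lemma lambda1_symb:
  assumes "x \<noteq> 0"
  shows "lambda1 (RP_gen x) = symb x"
proof (cases "x = 1")
  case True then show ?thesis by (simp add: RP_gen_one symb_one)
next
  case False then show ?thesis using assms by (simp add: lambda1_RP_gen symb_def)
qed

text \<open>The map \<open>J\<close> is twice the projection to the -1-part, followed by
  localisation. Its target has no 2-torsion, so \<open>symb_injective\<close> gives
  \<open>J m = 0\<close>, and \<open>tens_eq_zero_iff\<close> makes this integral again.\<close>

lemma lambda1_kernel_minus: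
  fixes m :: "'a::field RP"
  assumes large: "infinite (UNIV :: 'a set) \<or> 4 \<le> card (UNIV :: 'a set)" and "lambda1 m = 0"
  shows "\<exists>k. int_scale (2 ^ k) (RP_scale (1 - sq (-1)) m) = 0"
proof -
  define J :: "'a RP \<Rightarrow> 'a RP loc2" where "J m = tens (RP_scale (1 - sq (-1)) m) 1" for m
  interpret RP: five_term_module RP_scale "RP_gen :: 'a \<Rightarrow> 'a RP"
    by (rule five_term_module_RP[OF large])
  interpret L: module "loc_scale RP_scale :: 'a sqring \<Rightarrow> _"
    by (rule module_loc_scale[OF module_RP_scale])
  interpret J: module_hom RP_scale "loc_scale RP_scale" J
    by unfold_locales
      (simp_all add: J_def RP_mod.scale_right_distrib tens_add_left loc_scale_tens module_RP_scale
        RP_mod.scale_left_commute mult.commute)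
  interpret F: five_term_module "loc_scale RP_scale" "\<lambda>x. J (RP_gen x)"
    by (rule RP.hom_image) unfold_locales
  interpret M: minus_five_term_module "loc_scale RP_scale" "\<lambda>x. J (RP_gen x)"
  proof
    show "loc_scale RP_scale (sq (-1)) (J (RP_gen x)) = - J (RP_gen x)" for x
    proof -
      have "sq (-1) * (1 - sq (-1)) = - (1 - sq (-1) :: 'a sqring)"
        by (simp add: right_diff_distrib sq_square)
      then show ?thesis
        by (simp add: J_def loc_scale_tens module_RP_scale flip: tens_neg_left RP_mod.scale_minus_left)
    qed
    show "t = 0" if "t + t = 0" for t :: "'a RP loc2"
      using that by (rule loc2_no_two_torsion)
  qed
  obtain p where p: "m = abs_RP p" by (induction m) auto
  have gen: "lambda1_gen u = symb (Rep_nzero u)" for u :: "'a nzero"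
    by (simp add: lambda1_gen_def Let_def symb_def)
  have "free_lift (*) lambda1_gen p = 0"
    using assms(2) by (simp add: p lambda1.abs_eq)
  then have "(\<Sum>u\<in>Poly_Mapping.keys p. Poly_Mapping.lookup p u * symb (Rep_nzero u)) = 0"
    by (simp add: free_lift_def gen)
  then have "(\<Sum>u\<in>Poly_Mapping.keys p. loc_scale RP_scale (Poly_Mapping.lookup p u)
      (J (RP_gen (Rep_nzero u)))) = 0"
    by (intro M.symb_injective) (simp_all add: Rep_nzero_nonzero)
  moreover have "m = (\<Sum>u\<in>Poly_Mapping.keys p. RP_scale (Poly_Mapping.lookup p u) (RP_gen (Rep_nzero u)))"
    unfolding p by (subst free_hom_eq_lift[OF abs_RP.module_hom_axioms])
      (simp only: free_lift_def free_gen_nzgen RP_gen_abs)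
  ultimately have "J m = 0" by (simp add: J.sum J.scale)
  then have "tens (RP_scale (1 - sq (-1)) m) (half ^ 0) = 0" by (simp add: J_def)
  then show ?thesis by (simp only: tens_eq_zero_iff)
qed

section \<open>The quotient map and its kernel\<close>

lift_definition RP_to_RPprime :: "'a::field RP \<Rightarrow> 'a RPprime" is "\<lambda>p. p"
  unfolding module_cong_def
  using free.span_mono[of RP_rels RPprime_rels] by (auto simp: RPprime_rels_def)

lemma RP_to_RPprime_abs: "RP_to_RPprime (abs_RP p) = abs_RPprime p"
  by (simp add: RP_to_RPprime.abs_eq)

interpretation quot: module_hom RP_scale RPprime_scale RP_to_RPprime
proof
  show "RP_to_RPprime (m + m') = RP_to_RPprime m + RP_to_RPprime m'" for m m' :: "'a RP"
    by (induction m; induction m')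
      (simp only: RP_to_RPprime_abs abs_RP.add [symmetric] abs_RPprime.add [symmetric])
  show "RP_to_RPprime (RP_scale r m) = RPprime_scale r (RP_to_RPprime m)" for r and m :: "'a RP"
    by (induction m)
      (simp only: RP_to_RPprime_abs abs_RP.scale [symmetric] abs_RPprime.scale [symmetric])
qed

lemma RP_to_RPprime_gen: "RP_to_RPprime (RP_gen x) = RPprime_gen x"
  by (simp add: RP_gen_abs RPprime_gen_abs RP_to_RPprime_abs)

lemma one_plus_minus_one: "(1 + sq (-1)) * sq (-1) = (1 + sq (-1) :: 'a::field sqring)"
  by (simp add: distrib_right sq_square add.commute)

text \<open>Since \<theta> kills the relations of \<open>RPprime\<close>, it kills \<open>m\<close>;
  as \<open>lambda1 m = 0\<close>, this controls the 1-part of \<open>m\<close>, and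
  \<open>lambda1_kernel_minus\<close> controls the other part.\<close>

lemma RP_to_RPprime_kernel:
  fixes m :: "'a::field RP"
  assumes large: "infinite (UNIV :: 'a set) \<or> 4 \<le> card (UNIV :: 'a set)"
    and lam: "lambda1 m = 0" and q: "RP_to_RPprime m = 0"
  shows "\<exists>k. int_scale (2 ^ k) m = 0"
proof -
  interpret RP: five_term_module RP_scale "RP_gen :: 'a \<Rightarrow> 'a RP"
    by (rule five_term_module_RP[OF large])
  let ?e = "1 + sq (-1) :: 'a sqring"
  have Psi_zero: "RP.Psi 0 = 0"
    by (rule additive_zero) (rule RP.Psi_add)
  \<comment> \<open>Additivity of \<open>Psi\<close> improves to linearity on the image of
    \<open>lambda1\<close>, which consists of sums of multiples of elements \<open>pf x\<close>,
    where \<open>Psi_pf\<close> applies.\<close>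
  have Psi_lambda1: "RP.Psi (r * lambda1 m) = RP_scale r (RP.Psi (lambda1 m))" for r m
  proof (induction m rule: RP_induct)
    case 1
    show ?case by (simp only: lambda1.zero mult_zero_right Psi_zero RP_mod.scale_zero_right)
  next
    case (2 m t x)
    have gen: "RP.Psi (r * symb x) = RP_scale (r * pf (1 - x)) (RP.psip x)" for r
      unfolding symb_def mult.assoc [symmetric] by (rule RP.Psi_pf[OF 2(1)])
    have "RP.Psi (r * lambda1 (m + RP_scale t (RP_gen x)))
        = RP.Psi (r * lambda1 m) + RP.Psi (r * t * symb x)"
      by (simp only: lambda1.add lambda1.scale lambda1_symb[OF 2(1)] distrib_left RP.Psi_add mult.assoc)
    also have "\<dots> = RP_scale r (RP.Psi (lambda1 m) + RP.Psi (t * symb x))"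
      by (simp only: 2(2) gen RP_mod.scale_right_distrib RP_mod.scale_scale) (simp only: mult.assoc)
    also have "RP.Psi (lambda1 m) + RP.Psi (t * symb x) = RP.Psi (lambda1 (m + RP_scale t (RP_gen x)))"
      by (simp only: lambda1.add lambda1.scale lambda1_symb[OF 2(1)] RP.Psi_add)
    finally show ?case .
  qed
  txt \<open>Four times the map \<open>\<theta>\<close> on the \<open>1\<close>-part.\<close>
  define \<theta> where "\<theta> m = RP_scale ?e (m + m) + RP.Psi (lambda1 m)" for m
  interpret \<theta>: module_hom RP_scale RP_scale \<theta>
    by unfold_locales
      (simp_all add: \<theta>_def lambda1.add lambda1.scale RP.Psi_add Psi_lambda1
        RP_mod.scale_right_distrib RP_mod.scale_left_commute[of _ ?e] algebra_simps)
  have e_minus: "RP_scale (sq (-1)) (RP_scale ?e t) = RP_scale ?e t" for t :: "'a RP"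
    by (simp only: RP_mod.scale_scale mult.commute[of "sq (-1)" ?e] one_plus_minus_one)
  have psip_minus: "RP_scale (sq (-1)) (RP.psip x) = RP.psip x" for x
    unfolding RP.psip_def by (rule e_minus)
  have \<theta>_gen: "\<theta> (RP_gen x) = RP_scale ?e (RP_gen x + RP_gen x) + RP_scale (pf (1 - x)) (RP.psip x)"
    if "x \<noteq> 0" for x
    using RP.Psi_pf[OF that, of "pf (1 - x)"] by (simp add: \<theta>_def lambda1_symb that symb_def)
  have \<theta>_minus: "\<theta> (RP_scale (sq (-1)) (RP_gen x) - RP_gen x) = 0" if "x \<noteq> 0" for x
    unfolding \<theta>.diff \<theta>.scale \<theta>_gen[OF that] RP_mod.scale_right_distrib e_minus
      RP_mod.scale_left_commute[of "sq (-1)" "pf (1 - x)"] psip_minus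
    by simp
  \<comment> \<open>The generators contribute \<open>?p + ?p\<close>. The \<open>pf\<close> terms
    contribute \<open>- ?p - ?p\<close>, because \<open>sq (1 - inverse x)\<close> acts on
    \<open>?p\<close> as the negative of \<open>sq (1 - x)\<close>.\<close>
  have \<theta>_inverse: "\<theta> (RP_gen x + RP_gen (inverse x)) = 0" if x: "x \<noteq> 0" for x
  proof (cases "x = 1")
    case True
    then show ?thesis by (simp add: RP_gen_one)
  next
    case False
    let ?p = "RP.psip x"
    have p: "RP_scale ?e (RP_gen x) + RP_scale ?e (RP_gen (inverse x)) = ?p"
      unfolding RP.psip_def RP.psi_def RP_mod.scale_right_distrib RP_mod.scale_scale one_plus_minus_one ..
    have pi: "RP.psip (inverse x) = ?p"
      unfolding RP.psip_def RP.psi_inverse RP_mod.scale_scale one_plus_minus_one ..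
    have ix: "inverse x \<noteq> 0" using x by simp
    have "\<theta> (RP_gen x + RP_gen (inverse x)) =
        ((RP_scale ?e (RP_gen x) + RP_scale ?e (RP_gen (inverse x)))
          + (RP_scale ?e (RP_gen x) + RP_scale ?e (RP_gen (inverse x))))
        + (RP_scale (pf (1 - x)) ?p + RP_scale (pf (1 - inverse x)) ?p)"
      unfolding \<theta>.add \<theta>_gen[OF x] \<theta>_gen[OF ix] pi RP_mod.scale_right_distrib
      by (simp only: add_ac)
    moreover have "RP_scale (pf (1 - x)) ?p = RP_scale (sq (1 - x)) ?p - ?p"
      by (simp add: pf_def RP_mod.scale_left_diff_distrib)
    moreover have "RP_scale (pf (1 - inverse x)) ?p = - RP_scale (sq (1 - x)) ?p - ?p"
    proof -
      have "sq (1 - inverse x) = sq (1 - x) * sq x * sq (-1)"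
        unfolding sq_one_diff_inverse[OF x False] by (simp only: mult_ac)
      then have "RP_scale (sq (1 - inverse x)) ?p = - RP_scale (sq (1 - x)) ?p"
        by (simp only: psip_minus RP.psip_self[OF x] RP_mod.scale_minus_right flip: RP_mod.scale_scale)
      then show ?thesis by (simp add: pf_def RP_mod.scale_left_diff_distrib)
    qed
    ultimately show ?thesis by (simp only: p) simp
  qed
  have \<theta>_rel: "\<theta> (abs_RP p) = 0" if "p \<in> RPprime_rels" for p
  proof -
    consider "p \<in> RP_rels" | x where "x \<noteq> 0" "p = fscale (sq (-1)) (nzgen x) - nzgen x"
      | x where "x \<noteq> 0" "p = nzgen x + nzgen (inverse x)"
      using \<open>p \<in> RPprime_rels\<close> by (auto simp: RPprime_rels_def)
    then show ?thesis
    proof cases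
      case 1
      then have "abs_RP p = 0" unfolding abs_RP_eq_0_iff by (rule free.span_base)
      then show ?thesis by simp
    next
      case (2 x)
      then show ?thesis
        using \<theta>_minus[of x] by (simp add: abs_RP.diff abs_RP.scale flip: RP_gen_abs)
    next
      case (3 x)
      then show ?thesis
        using \<theta>_inverse[of x] by (simp add: abs_RP.add flip: RP_gen_abs)
    qed
  qed
  obtain p where p: "m = abs_RP p" by (induction m) auto
  have "p \<in> free.span RPprime_rels"
    using q by (simp add: p RP_to_RPprime_abs abs_RPprime_eq_0_iff)
  then have "\<theta> (abs_RP p) = 0"
    by (induction rule: free.span_induct_alt)
      (simp_all add: \<theta>_rel abs_RP.add abs_RP.scale \<theta>.add \<theta>.scale)
  then have plus: "RP_scale ?e (m + m) = 0"
    by (simp add: \<theta>_def lam Psi_zero flip: p)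
  obtain k where k: "int_scale (2 ^ k) (RP_scale (1 - sq (-1)) m) = 0"
    using lambda1_kernel_minus[OF large lam] by blast
  \<comment> \<open>Twice \<open>1 + sq (-1)\<close> plus twice \<open>1 - sq (-1)\<close> is 4, so
    the two parts recover \<open>4 m\<close>.\<close>
  have "RP_scale ?e (m + m) + RP_scale (1 - sq (-1)) m + RP_scale (1 - sq (-1)) m = (m + m) + (m + m)"
    by (simp add: RP_mod.scale_left_distrib RP_mod.scale_left_diff_distrib RP_mod.scale_right_distrib)
  also have "\<dots> = int_scale (2 ^ 2) m"
    using int_mod.scale_left_distrib[of 2 2 m] int_mod.scale_left_distrib[of 1 1 m] by simp
  finally have four: "int_scale (2 ^ 2) m = RP_scale (1 - sq (-1)) m + RP_scale (1 - sq (-1)) m"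
    by (simp only: plus add_0)
  have "int_scale (2 ^ k) (int_scale (2 ^ 2) m) = 0"
    unfolding four int_mod.scale_right_distrib k by simp
  then have "int_scale (2 ^ (k + 2)) m = 0" by (simp only: int_mod.scale_scale power_add)
  then show ?thesis by blast
qed

section \<open>An integral section up to the factor 2\<close>

text \<open>Twice the prescribed image of \<open>[x]'\<close>, so that no localisation is needed.\<close>

definition twice_section :: "'a::field \<Rightarrow> 'a RP"
  where "twice_section x = RP_scale (1 + sq (-1)) (RP_gen x) + RP_scale (pf (1 - x)) (psi1 x)"

text \<open>This is \<open>lambda1 (twice_section x) = 0\<close> with \<open>a\<close>,
  \<open>b\<close>, \<open>n\<close> for the classes of \<open>x\<close>, \<open>1 - x\<close>, -1;
  then \<open>n * a * b\<close> is the class of \<open>1 - inverse x\<close>.\<close>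

lemma symb_section_identity:
  fixes a b n :: "'r::comm_ring_1"
  assumes "a * a = 1" "b * b = 1" "n * n = 1"
  shows "(1 + n) * ((b - 1) * (a - 1))
    + (b - 1) * ((b - 1) * (a - 1) + n * ((n * a * b - 1) * (a - 1))) = 0"
proof -
  have [simp]: "a * (a * z) = z" "b * (b * z) = z" "n * (n * z) = z" for z
    by (simp_all add: assms mult.assoc [symmetric])
  show ?thesis by (simp add: assms algebra_simps)
qed

lemma lambda1_twice_section:
  assumes "x \<noteq> 0" "x \<noteq> 1"
  shows "lambda1 (twice_section x) = 0"
proof -
  have "sq x * sq x = 1" "sq (1 - x) * sq (1 - x) = 1" "sq (-1) * sq (-1) = (1 :: 'a sqring)"
    using assms by (simp_all add: sq_square)
  from symb_section_identity[OF this] show ?thesis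
    using assms
    by (simp add: twice_section_def psi1_def lambda1.add lambda1.scale lambda1_symb symb_def pf_def
        sq_inverse sq_one_diff_inverse)
qed

text \<open>The extra relations of \<open>RPprime\<close> kill the image of \<open>psi1 x\<close>
  and make \<open>1 + sq (-1)\<close> act as 2.\<close>

lemma RP_to_RPprime_twice_section:
  assumes "x \<noteq> 0"
  shows "RP_to_RPprime (twice_section x) = RPprime_gen x + RPprime_gen x"
  using assms RPprime_inverse[of x]
  by (simp add: twice_section_def psi1_def quot.add quot.scale RP_to_RPprime_gen
      RPprime_mod.scale_left_distrib RPprime_minus_one)

text \<open>Supplies the factor 2 with which \<open>surj_loc_map\<close> is applied; preimages are
  built from \<open>twice_section\<close>.\<close>

lemma RP1_to_RPprime_twice_surj:
  "\<exists>z. RP_to_RPprime (Rep_RP1 z) = b + b"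
proof (induction b rule: RPprime_induct)
  case 1
  show ?case by (rule exI[of _ 0]) (simp add: zero_RP1.rep_eq)
next
  case (2 b r x)
  then obtain z where z: "RP_to_RPprime (Rep_RP1 z) = b + b" by blast
  show ?case
  proof (cases "x = 1")
    case True
    then show ?thesis using z by (auto simp: RPprime_gen_one)
  next
    case False
    let ?z = "z + RP1_scale r (Abs_RP1 (twice_section x))"
    have "Rep_RP1 (Abs_RP1 (twice_section x)) = twice_section x"
      using lambda1_twice_section[OF 2(1) False] by (simp add: Abs_RP1_inverse)
    then have "RP_to_RPprime (Rep_RP1 ?z) =
        (b + RPprime_scale r (RPprime_gen x)) + (b + RPprime_scale r (RPprime_gen x))"
      using 2(1) by (simp add: plus_RP1.rep_eq RP1_scale.rep_eq quot.add quot.scale z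
          RP_to_RPprime_twice_section RPprime_mod.scale_right_distrib)
    then show ?thesis by blast
  qed
qed

section \<open>The comparison map as the inverse of the localised quotient map\<close>

interpretation RP1_mod: module RP1_scale
  by (rule module_RP1_scale)

interpretation incl: module_hom RP1_scale RP_scale Rep_RP1
  by unfold_locales (simp_all add: plus_RP1.rep_eq RP1_scale.rep_eq)

lemma Rep_RP1_eq_0_iff: "Rep_RP1 z = 0 \<longleftrightarrow> z = 0"
  by (metis Rep_RP1_inject zero_RP1.rep_eq)

text \<open>Values prescribed in the localisation of \<open>RP\<close> therefore determine the
  values in that of \<open>RP1\<close>.\<close>

lemma inj_loc_map_Rep_RP1: "inj (loc_map Rep_RP1)"
proof (rule inj_loc_map)
  show "Rep_RP1 (a + b) = Rep_RP1 a + Rep_RP1 b" for a b :: "'a RP1" by (rule incl.add)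
  show "\<exists>k. int_scale (2 ^ k) a = 0" if "Rep_RP1 a = 0" for a :: "'a RP1"
    using that by (simp add: Rep_RP1_eq_0_iff)
qed

definition RP1_to_RPprime :: "'a::field RP1 \<Rightarrow> 'a RPprime"
  where "RP1_to_RPprime z = RP_to_RPprime (Rep_RP1 z)"

interpretation RP1_quot: module_hom RP1_scale RPprime_scale RP1_to_RPprime
  by unfold_locales (simp_all add: RP1_to_RPprime_def incl.add incl.scale quot.add quot.scale)

lemma bij_loc_map_RP1_to_RPprime:
  assumes "infinite (UNIV :: 'a::field set) \<or> 4 \<le> card (UNIV :: 'a set)"
  shows "bij (loc_map (RP1_to_RPprime :: 'a RP1 \<Rightarrow> _))"
proof (rule bijI)
  show "inj (loc_map (RP1_to_RPprime :: 'a RP1 \<Rightarrow> _))"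
  proof (rule inj_loc_map[OF RP1_quot.add])
    fix a :: "'a RP1" assume "RP1_to_RPprime a = 0"
    then obtain k where "int_scale (2 ^ k) (Rep_RP1 a) = 0"
      using RP_to_RPprime_kernel[OF assms, of "Rep_RP1 a"] Rep_RP1[of a]
      by (auto simp: RP1_to_RPprime_def)
    then have "Rep_RP1 (int_scale (2 ^ k) a) = 0"
      by (simp only: additive_int_scale[of Rep_RP1, OF incl.add])
    then show "\<exists>k. int_scale (2 ^ k) a = 0" unfolding Rep_RP1_eq_0_iff by blast
  qed
  show "surj (loc_map (RP1_to_RPprime :: 'a RP1 \<Rightarrow> _))"
  proof (rule surj_loc_map[OF RP1_quot.add])
    fix b :: "'a RPprime"
    have "b + b = int_scale (2 ^ 1) b" using int_mod.scale_left_distrib[of 1 1 b] by simp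
    then show "\<exists>k a. RP1_to_RPprime a = int_scale (2 ^ k) b"
      unfolding RP1_to_RPprime_def using RP1_to_RPprime_twice_surj[of b] by metis
  qed
qed

lemma comparison_value:
  "loc_act RP_scale e_plus (tens (RP_gen x) 1)
    + loc_act RP_scale (tens (pf (1 - x)) half) (tens (psi1 x) 1) = tens (twice_section x) half"
  unfolding e_plus_def loc_act_tens[OF module_RP_scale] twice_section_def
  by (simp only: tens_add_left mult_1_right)

lemma comparison_hom_unique:
  assumes \<phi>: "comparison_hom \<phi>" and \<psi>: "comparison_hom (\<psi> :: 'a::field RPprime loc2 \<Rightarrow> 'a RP1 loc2)"
  shows "\<phi> = \<psi>"
proof -
  have "module_hom (loc_scale RPprime_scale) (loc_scale RP1_scale) \<phi>"
    using \<phi> by (simp add: comparison_hom_def)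
  then interpret \<phi>: module_hom "loc_scale RPprime_scale" "loc_scale RP1_scale" \<phi> .
  have "module_hom (loc_scale RPprime_scale) (loc_scale RP1_scale) \<psi>"
    using \<psi> by (simp add: comparison_hom_def)
  then interpret \<psi>: module_hom "loc_scale RPprime_scale" "loc_scale RP1_scale" \<psi> .
  have gen: "\<phi> (tens (RPprime_gen x) 1) = \<psi> (tens (RPprime_gen x) 1)" if "x \<noteq> 0" for x
  proof (cases "x = 1")
    case True
    then show ?thesis using \<phi> \<psi> by (simp add: comparison_hom_def)
  next
    case False
    then have "loc_map Rep_RP1 (\<phi> (tens (RPprime_gen x) 1)) = loc_map Rep_RP1 (\<psi> (tens (RPprime_gen x) 1))"
      using \<phi> \<psi> that by (simp add: comparison_hom_def)
    then show ?thesis by (rule injD[OF inj_loc_map_Rep_RP1])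
  qed
  have "\<phi> (tens b 1) = \<psi> (tens b 1)" for b
  proof (induction b rule: RPprime_induct)
    case 1
    show ?case by (simp add: tens_zero_left)
  next
    case (2 b r x)
    then show ?case using gen[of x]
      by (simp add: tens_add_left \<phi>.add \<psi>.add \<phi>.scale \<psi>.scale
          flip: loc_scale_tens[OF module_RPprime_scale])
  qed
  then show ?thesis by (rule loc2_additive_eqI[OF \<phi>.add \<psi>.add])
qed

text \<open>Taking an inverse settles well-definedness and linearity; the prescribed values are then
  found by exhibiting preimages.\<close>

lemma comparison_hom_inv:
  assumes "infinite (UNIV :: 'a::field set) \<or> 4 \<le> card (UNIV :: 'a set)"
  shows "comparison_hom (inv (loc_map (RP1_to_RPprime :: 'a RP1 \<Rightarrow> _)))"
proof -
  let ?\<rho> = "loc_map (RP1_to_RPprime :: 'a RP1 \<Rightarrow> _)"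
  have bij: "bij ?\<rho>" by (rule bij_loc_map_RP1_to_RPprime[OF assms])
  then have inv: "?\<rho> (inv ?\<rho> t) = t" for t by (simp add: bij_is_surj surj_f_inv_f)
  interpret \<rho>: module_hom "loc_scale RP1_scale" "loc_scale RPprime_scale" ?\<rho>
    by (rule module_hom_loc_map) unfold_locales
  have inv_eqI: "inv ?\<rho> t = u" if "?\<rho> u = t" for t u
    using bij that by (metis bij_is_inj inv_f_f)
  have val: "loc_map Rep_RP1 (inv ?\<rho> (tens (RPprime_gen x) 1)) = tens (twice_section x) half"
    if x: "x \<noteq> 0" "x \<noteq> 1" for x :: 'a
  proof -
    have Rep: "Rep_RP1 (Abs_RP1 (twice_section x)) = twice_section x"
      using lambda1_twice_section[OF x] by (simp add: Abs_RP1_inverse)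
    \<comment> \<open>The prescribed value, half of \<open>twice_section x\<close>, maps to half of
      twice the generator.\<close>
    have "?\<rho> (tens (Abs_RP1 (twice_section x)) half) = tens (RPprime_gen x + RPprime_gen x) half"
      by (simp only: loc_map_tens[of RP1_to_RPprime, OF RP1_quot.add] RP1_to_RPprime_def Rep
          RP_to_RPprime_twice_section[OF x(1)])
    also have "\<dots> = tens (RPprime_gen x) (half + half)"
      by (simp only: tens_add_left tens_add_right)
    also have "half + half = 1" using two_half by simp
    finally have "inv ?\<rho> (tens (RPprime_gen x) 1) = tens (Abs_RP1 (twice_section x)) half"
      by (rule inv_eqI)
    then show ?thesis by (simp add: loc_map_tens[of Rep_RP1, OF incl.add] Rep)
  qed
  have "module_hom (loc_scale RPprime_scale) (loc_scale RP1_scale) (inv ?\<rho>)"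
  proof unfold_locales
    show "inv ?\<rho> (t + u) = inv ?\<rho> t + inv ?\<rho> u" for t u
      by (rule inv_eqI) (simp add: \<rho>.add inv)
    show "inv ?\<rho> (loc_scale RPprime_scale r t) = loc_scale RP1_scale r (inv ?\<rho> t)" for r t
      by (rule inv_eqI) (simp add: \<rho>.scale inv)
  qed
  moreover have "inv ?\<rho> (tens (RPprime_gen 1) 1) = 0"
    by (rule inv_eqI) (simp add: RPprime_gen_one tens_zero_left)
  ultimately show ?thesis
    unfolding comparison_hom_def comparison_value using val by blast
qed

theorem corollary4p5:
  assumes "infinite (UNIV :: 'a::field set) \<or> 4 \<le> card (UNIV :: 'a set)"
  shows "(\<exists>!\<phi> :: 'a RPprime loc2 \<Rightarrow> 'a RP1 loc2. comparison_hom \<phi>) \<and>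
    (\<forall>\<phi> :: 'a RPprime loc2 \<Rightarrow> 'a RP1 loc2. comparison_hom \<phi> \<longrightarrow> bij \<phi>)"
proof -
  have "bij (inv (loc_map (RP1_to_RPprime :: 'a RP1 \<Rightarrow> _)))"
    by (rule bij_imp_bij_inv[OF bij_loc_map_RP1_to_RPprime[OF assms]])
  then show ?thesis
    using comparison_hom_inv[OF assms] comparison_hom_unique by metis
qed

end
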